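(* There is an algorithm for the Vector Domination Problem and a function $s:(0,\infty)\to(0,1)$, polynomial in $\frac1c$ (in the sense that there exist absolute constants $\delta>0$ and $K>0$ with $s(c)\ge\delta\,c^{-K}$ for all $c\ge1$), such that for inputs $A,B\subseteq\mathbb{R}^d$ with $|A|=|B|=N$ and $d=c\log N$ the algorithm runs in time $O\left(N^{2-s(c)}\right)$.
   Context: For vectors $u,v\in\mathbb{R}^d$, $u\ge v$ means $u_k\ge v_k$ for every coordinate $k=1,\dots,d$. The Vector Domination Problem is: given two finite sets $A,B$ of $d$-dimensional real vectors, find $u\in A$ and $v\in B$ such that $u\ge v$, or determine that no such pair exists. $\log$ denotes the logarithm to base $2$. Running time counts elementary operations, where arithmetic operations and comparisons on real numbers have unit cost. The parameter $c$ is treated as a constant (fixed as $N$ grows), and the constant hidden in $O(\cdot)$ may depend on $c$. *)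

theory Defs
  imports Complex_Main
begin

section \<open>Vector domination\<close>

text \<open>Vectors of \<open>\<real>\<^sup>d\<close> are lists of length \<open>d\<close>, since the dimension varies with the input.\<close>

definition dominates :: "real list \<Rightarrow> real list \<Rightarrow> bool" where
  "dominates u v \<longleftrightarrow> length u = length v \<and> (\<forall>k < length u. u ! k \<ge> v ! k)"

section \<open>The real RAM\<close>

text \<open>
  A unit-cost random access machine with two sorts of data, presented as a structured language.
  Natural numbers, which also serve as array addresses, support only addition, truncated
  subtraction and comparison. Unit-cost multiplication or division of unbounded integers is
  deliberately absent, because it would allow a large amount of data to be packed into a single
  cell. Reals support the four arithmetic operations and comparison; there is no rounding and no
  conversion from reals to naturals. Only rational constants occur in programs, so that a program
  cannot carry infinitely many bits of advice. A program uses finitely many registers and arrays;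
  the arrays are unbounded.
\<close>

type_synonym name = string

datatype nexp =
    NConst nat
  | NReg name
  | NArr name nexp
  | NAdd nexp nexp
  | NSub nexp nexp

datatype rexp =
    RConst rat
  | RReg name
  | RArr name nexp
  | RAdd rexp rexp
  | RSub rexp rexp
  | RMul rexp rexp
  | RDiv rexp rexp

datatype bexp =
    NLess nexp nexp
  | RLess rexp rexp
  | Neg bexp
  | Conj bexp bexp

datatype com =
    Skip
  | NAssign name nexp
  | RAssign name rexp
  | NStore name nexp nexp  \<comment> \<open>array, address, value\<close>
  | RStore name nexp rexp
  | Seq com com
  | Cond bexp com com
  | While bexp com

record state =
  nreg :: "name \<Rightarrow> nat"
  rreg :: "name \<Rightarrow> real"
  narr :: "name \<Rightarrow> nat \<Rightarrow> nat"
  rarr :: "name \<Rightarrow> nat \<Rightarrow> real"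

fun nval :: "nexp \<Rightarrow> state \<Rightarrow> nat" where
  "nval (NConst n) \<sigma> = n"
| "nval (NReg x) \<sigma> = nreg \<sigma> x"
| "nval (NArr a e) \<sigma> = narr \<sigma> a (nval e \<sigma>)"
| "nval (NAdd e f) \<sigma> = nval e \<sigma> + nval f \<sigma>"
| "nval (NSub e f) \<sigma> = nval e \<sigma> - nval f \<sigma>"

fun rval :: "rexp \<Rightarrow> state \<Rightarrow> real" where
  "rval (RConst q) \<sigma> = of_rat q"
| "rval (RReg x) \<sigma> = rreg \<sigma> x"
| "rval (RArr a e) \<sigma> = rarr \<sigma> a (nval e \<sigma>)"
| "rval (RAdd e f) \<sigma> = rval e \<sigma> + rval f \<sigma>"
| "rval (RSub e f) \<sigma> = rval e \<sigma> - rval f \<sigma>"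
| "rval (RMul e f) \<sigma> = rval e \<sigma> * rval f \<sigma>"
| "rval (RDiv e f) \<sigma> = rval e \<sigma> / rval f \<sigma>"

fun bval :: "bexp \<Rightarrow> state \<Rightarrow> bool" where
  "bval (NLess e f) \<sigma> \<longleftrightarrow> nval e \<sigma> < nval f \<sigma>"
| "bval (RLess e f) \<sigma> \<longleftrightarrow> rval e \<sigma> < rval f \<sigma>"
| "bval (Neg b) \<sigma> \<longleftrightarrow> \<not> bval b \<sigma>"
| "bval (Conj b b') \<sigma> \<longleftrightarrow> bval b \<sigma> \<and> bval b' \<sigma>"

text \<open>Every constant, register access, array access, operation and comparison costs one unit.\<close>

fun ncost :: "nexp \<Rightarrow> nat" where
  "ncost (NConst n) = 1"
| "ncost (NReg x) = 1"
| "ncost (NArr a e) = ncost e + 1"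
| "ncost (NAdd e f) = ncost e + ncost f + 1"
| "ncost (NSub e f) = ncost e + ncost f + 1"

fun rcost :: "rexp \<Rightarrow> nat" where
  "rcost (RConst q) = 1"
| "rcost (RReg x) = 1"
| "rcost (RArr a e) = ncost e + 1"
| "rcost (RAdd e f) = rcost e + rcost f + 1"
| "rcost (RSub e f) = rcost e + rcost f + 1"
| "rcost (RMul e f) = rcost e + rcost f + 1"
| "rcost (RDiv e f) = rcost e + rcost f + 1"

fun bcost :: "bexp \<Rightarrow> nat" where
  "bcost (NLess e f) = ncost e + ncost f + 1"
| "bcost (RLess e f) = rcost e + rcost f + 1"
| "bcost (Neg b) = bcost b + 1"
| "bcost (Conj b b') = bcost b + bcost b' + 1"

text \<open>
  \<open>exec p \<sigma> t \<tau>\<close>: started in state \<open>\<sigma>\<close>, the program \<open>p\<close> terminates in state \<open>\<tau>\<close> after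
  exactly \<open>t\<close> elementary operations.
\<close>

inductive exec :: "com \<Rightarrow> state \<Rightarrow> nat \<Rightarrow> state \<Rightarrow> bool" where
  Skip: "exec Skip \<sigma> 1 \<sigma>"
| NAssign: "exec (NAssign x e) \<sigma> (ncost e + 1) (\<sigma>\<lparr>nreg := (nreg \<sigma>)(x := nval e \<sigma>)\<rparr>)"
| RAssign: "exec (RAssign x e) \<sigma> (rcost e + 1) (\<sigma>\<lparr>rreg := (rreg \<sigma>)(x := rval e \<sigma>)\<rparr>)"
| NStore: "exec (NStore a i e) \<sigma> (ncost i + ncost e + 1)
    (\<sigma>\<lparr>narr := (narr \<sigma>)(a := (narr \<sigma> a)(nval i \<sigma> := nval e \<sigma>))\<rparr>)"
| RStore: "exec (RStore a i e) \<sigma> (ncost i + rcost e + 1)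
    (\<sigma>\<lparr>rarr := (rarr \<sigma>)(a := (rarr \<sigma> a)(nval i \<sigma> := rval e \<sigma>))\<rparr>)"
| Seq: "exec p \<sigma> t \<sigma>' \<Longrightarrow> exec q \<sigma>' t' \<sigma>'' \<Longrightarrow> exec (Seq p q) \<sigma> (t + t') \<sigma>''"
| CondTrue: "bval b \<sigma> \<Longrightarrow> exec p \<sigma> t \<sigma>' \<Longrightarrow> exec (Cond b p q) \<sigma> (bcost b + t) \<sigma>'"
| CondFalse: "\<not> bval b \<sigma> \<Longrightarrow> exec q \<sigma> t \<sigma>' \<Longrightarrow> exec (Cond b p q) \<sigma> (bcost b + t) \<sigma>'"
| WhileFalse: "\<not> bval b \<sigma> \<Longrightarrow> exec (While b p) \<sigma> (bcost b) \<sigma>"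
| WhileTrue: "bval b \<sigma> \<Longrightarrow> exec p \<sigma> t \<sigma>' \<Longrightarrow> exec (While b p) \<sigma>' t' \<sigma>''
    \<Longrightarrow> exec (While b p) \<sigma> (bcost b + t + t') \<sigma>''"

inductive_cases SkipE: "exec Skip \<sigma> t \<tau>"
inductive_cases NAssignE: "exec (NAssign x e) \<sigma> t \<tau>"
inductive_cases RAssignE: "exec (RAssign x e) \<sigma> t \<tau>"
inductive_cases NStoreE: "exec (NStore a i e) \<sigma> t \<tau>"
inductive_cases RStoreE: "exec (RStore a i e) \<sigma> t \<tau>"
inductive_cases SeqE: "exec (Seq p q) \<sigma> t \<tau>"
inductive_cases CondE: "exec (Cond b p q) \<sigma> t \<tau>"
inductive_cases WhileE: "exec (While b p) \<sigma> t \<tau>"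

lemma exec_deterministic:
  "exec p \<sigma> t \<tau> \<Longrightarrow> exec p \<sigma> t' \<tau>' \<Longrightarrow> t' = t \<and> \<tau>' = \<tau>"
proof (induction arbitrary: t' \<tau>' rule: exec.induct)
  case Skip then show ?case by (auto elim: SkipE)
next
  case NAssign then show ?case by (auto elim: NAssignE)
next
  case RAssign then show ?case by (auto elim: RAssignE)
next
  case NStore then show ?case by (auto elim: NStoreE)
next
  case RStore then show ?case by (auto elim: RStoreE)
next
  case Seq then show ?case by (blast elim: SeqE)
next
  case CondTrue then show ?case by (blast elim: CondE)
next
  case CondFalse then show ?case by (blast elim: CondE)
next
  case WhileFalse then show ?case by (blast elim: WhileE)
next
  case WhileTrue then show ?case by (blast elim: WhileE)
qed

definition halts_within :: "com \<Rightarrow> state \<Rightarrow> real \<Rightarrow> bool" where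
  "halts_within p \<sigma> r \<longleftrightarrow> (\<exists>t \<tau>. exec p \<sigma> t \<tau> \<and> real t \<le> r)"

section \<open>Input and output conventions\<close>

definition enumerates :: "nat \<Rightarrow> real list list \<Rightarrow> real list set \<Rightarrow> bool" where
  "enumerates d xs A \<longleftrightarrow> distinct xs \<and> set xs = A \<and> (\<forall>u\<in>A. length u = d)"

text \<open>
  Both sets are given in an arbitrary order, stored consecutively: coordinate \<open>k\<close> of the
  \<open>i\<close>-th vector is at address \<open>i * d + k\<close>. All remaining memory is initially zero.
\<close>

definition flat :: "nat \<Rightarrow> real list list \<Rightarrow> nat \<Rightarrow> real" where
  "flat d xs k = (if k < length xs * d then xs ! (k div d) ! (k mod d) else 0)"

definition input_state :: "nat \<Rightarrow> real list list \<Rightarrow> real list list \<Rightarrow> state" where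
  "input_state d xs ys = \<lparr>
     nreg = (\<lambda>_. 0)(''sizeA'' := length xs, ''sizeB'' := length ys, ''dim'' := d),
     rreg = (\<lambda>_. 0),
     narr = (\<lambda>_ _. 0),
     rarr = (\<lambda>_ _. 0)(''A'' := flat d xs, ''B'' := flat d ys)\<rparr>"

text \<open>
  If a dominating pair exists, the program sets \<open>found\<close> to 1 and the registers \<open>i\<close>, \<open>j\<close> to the
  positions of such a pair in the input arrays; otherwise it sets \<open>found\<close> to 0.
\<close>

definition correct_output :: "real list list \<Rightarrow> real list list \<Rightarrow> state \<Rightarrow> bool" where
  "correct_output xs ys \<tau> \<longleftrightarrow>
     nreg \<tau> ''found'' = 1 \<and> nreg \<tau> ''i'' < length xs \<and> nreg \<tau> ''j'' < length ys \<and>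
       dominates (xs ! nreg \<tau> ''i'') (ys ! nreg \<tau> ''j'')
   \<or> nreg \<tau> ''found'' = 0 \<and> \<not> (\<exists>u \<in> set xs. \<exists>v \<in> set ys. dominates u v)"

definition solves_vector_domination :: "com \<Rightarrow> bool" where
  "solves_vector_domination p \<longleftrightarrow>
     (\<forall>d A B xs ys. enumerates d xs A \<longrightarrow> enumerates d ys B \<longrightarrow>
        (\<exists>t \<tau>. exec p (input_state d xs ys) t \<tau> \<and> correct_output xs ys \<tau>))"

end

(* Divide and conquer over the coordinates. A subproblem is a set of n points of A and m points of
   B in which every pair already satisfies u_i >= v_i for i < k. Sort it by coordinate k, give each
   point of A the weight m and each point of B the weight n (total 2nm), and take as pivot the point
   at which the weight of the prefix reaches nm. The pivot is compared with all other points. A pair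
   of remaining points lies before the pivot, or after it, or has u after and v before it; the first
   two cases are subproblems for the same k, the third is one for k + 1.

   Let h bound the fraction of A after and of B before the pivot; by the choice of the weights the
   fractions of B after and of A before are at most 1 - h. With the potential
   N^th (nm)^(1-th) (1-mu)^(k-d), one step multiplies the total by at most
   2 (h(1-h))^(1-th) + (1-mu) h^(2(1-th)), which is below 1 when th = eta^4 and mu is a
   suitable multiple of eta^6: for th = mu = 0 it is 1 - (1-h)^2, and the loss through th, of order
   eta^3 (1-h), is compensated by mu. The initial potential is N^(2-th) (1-mu)^(-d), and since mu is
   small compared with th if eta^2 is small compared with 1/c, this is at most N^(2-th/2), up to
   constants, for d = c log N. *)

theory Submission
  imports Defs "HOL-Library.Multiset"
begin

section \<open>Weakest preconditions with time\<close>

text \<open>The weights treat the fractions of A and of B alike even when n and m are far apart: on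
  either side of the pivot the two fractions sum to at most 1, and since the pivot belongs to one
  set only, the fractions of the other set sum to exactly 1, which fixes h. The obstacle is h near
  1: the third subproblem may then be as large as the original one, and nothing but the advance of
  the coordinate is gained, so the factor in k is indispensable. For products near 0, w^(1-th)
  exceeds w by an unbounded factor; Young's inequality with second base th replaces this by the
  factor th^(-th) and an additive th^2. The factor N^th pays for the work on a subproblem: M =
  max(n, m) is at most N and at most nm, so N^th (nm)^(1-th) >= M, while (nm)^(1-th) alone would not
  cover a linear cost if one of the sets is tiny. Neither c nor eta occurs in the program; they
  enter through the potential only, so one program serves all c.\<close>

notation Seq (infixr \<open>;;\<close> 60)

text \<open>Termination is part of the claim. By \<open>exec_deterministic\<close> there is only one
  run, so the existential quantifier is as strong as a universal one.\<close>

definition wp :: "com \<Rightarrow> state \<Rightarrow> (nat \<Rightarrow> state \<Rightarrow> bool) \<Rightarrow> bool" where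
  "wp p \<sigma> Q \<longleftrightarrow> (\<exists>t \<tau>. exec p \<sigma> t \<tau> \<and> Q t \<tau>)"

definition setN :: "name \<Rightarrow> nat \<Rightarrow> state \<Rightarrow> state" where
  "setN x v \<sigma> = \<sigma>\<lparr>nreg := (nreg \<sigma>)(x := v)\<rparr>"

definition setR :: "name \<Rightarrow> nat \<Rightarrow> real \<Rightarrow> state \<Rightarrow> state" where
  "setR a i v \<sigma> = \<sigma>\<lparr>rarr := (rarr \<sigma>)(a := (rarr \<sigma> a)(i := v))\<rparr>"

text \<open>A list variable is an array together with the register of the same name, holding the length.\<close>

definition lst :: "name \<Rightarrow> state \<Rightarrow> nat list" where
  "lst X \<sigma> = map (narr \<sigma> X) [0..<nreg \<sigma> X]"

definition push :: "name \<Rightarrow> nat \<Rightarrow> state \<Rightarrow> state" where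
  "push X v \<sigma> = \<sigma>\<lparr>narr := (narr \<sigma>)(X := (narr \<sigma> X)(nreg \<sigma> X := v)),
                 nreg := (nreg \<sigma>)(X := nreg \<sigma> X + 1)\<rparr>"

definition Push :: "name \<Rightarrow> nexp \<Rightarrow> com" where
  "Push X e = Seq (NStore X (NReg X) e) (NAssign X (NAdd (NReg X) (NConst 1)))"

lemma wp_Skip [simp]: "wp Skip \<sigma> Q \<longleftrightarrow> Q 1 \<sigma>"
  unfolding wp_def by (metis SkipE exec.Skip)

lemma wp_NAssign [simp]: "wp (NAssign x e) \<sigma> Q \<longleftrightarrow> Q (ncost e + 1) (setN x (nval e \<sigma>) \<sigma>)"
  unfolding wp_def setN_def by (auto elim: NAssignE intro: exec.NAssign[simplified])

lemma wp_RStore [simp]: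
  "wp (RStore a i e) \<sigma> Q \<longleftrightarrow> Q (ncost i + rcost e + 1) (setR a (nval i \<sigma>) (rval e \<sigma>) \<sigma>)"
  unfolding wp_def setR_def by (auto elim: RStoreE intro: exec.RStore[simplified])

lemma wp_Seq [simp]: "wp (Seq p q) \<sigma> Q \<longleftrightarrow> wp p \<sigma> (\<lambda>t \<tau>. wp q \<tau> (\<lambda>t'. Q (t + t')))"
  unfolding wp_def by (blast elim: SeqE intro: exec.Seq)

lemma wp_Cond [simp]:
  "wp (Cond b p q) \<sigma> Q \<longleftrightarrow>
    (if bval b \<sigma> then wp p \<sigma> (\<lambda>t. Q (bcost b + t)) else wp q \<sigma> (\<lambda>t. Q (bcost b + t)))"
  unfolding wp_def by (auto elim!: CondE intro: exec.CondTrue exec.CondFalse)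

lemma wp_Push [simp]: "wp (Push X e) \<sigma> Q \<longleftrightarrow> Q (ncost e + 6) (push X (nval e \<sigma>) \<sigma>)"
proof -
  let ?\<tau> = "\<sigma>\<lparr>narr := (narr \<sigma>)(X := (narr \<sigma> X)(nreg \<sigma> X := nval e \<sigma>))\<rparr>"
  have "exec (NStore X (NReg X) e) \<sigma> (ncost e + 2) ?\<tau>"
    using exec.NStore[of X "NReg X" e \<sigma>] by simp
  then have "(\<exists>t \<tau>. exec (NStore X (NReg X) e) \<sigma> t \<tau> \<and> P t \<tau>) \<longleftrightarrow> P (ncost e + 2) ?\<tau>" for P
    by (blast dest: exec_deterministic)
  then have *: "wp (NStore X (NReg X) e) \<sigma> P \<longleftrightarrow>
    P (ncost e + 2) (\<sigma>\<lparr>narr := (narr \<sigma>)(X := (narr \<sigma> X)(nreg \<sigma> X := nval e \<sigma>))\<rparr>)" for P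
    by (simp add: wp_def)
  show ?thesis by (simp add: Push_def * push_def setN_def eval_nat_numeral)
qed

lemma wp_mono: "wp p \<sigma> Q \<Longrightarrow> (\<And>t \<tau>. Q t \<tau> \<Longrightarrow> Q' t \<tau>) \<Longrightarrow> wp p \<sigma> Q'"
  by (auto simp: wp_def)

text \<open>Registers and arrays share one set of names, since a list variable uses its name for
  both.\<close>

fun wr :: "com \<Rightarrow> name set" where
  "wr Skip = {}"
| "wr (NAssign x e) = {x}"
| "wr (RAssign x e) = {x}"
| "wr (NStore a i e) = {a}"
| "wr (RStore a i e) = {a}"
| "wr (Seq p q) = wr p \<union> wr q"
| "wr (Cond b p q) = wr p \<union> wr q"
| "wr (While b p) = wr p"

lemma wr_Push [simp]: "wr (Push X e) = {X}"
  by (simp add: Push_def)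

text \<open>Real registers are omitted: the program keeps its reals in arrays.\<close>

definition frame :: "name set \<Rightarrow> state \<Rightarrow> state \<Rightarrow> bool" where
  "frame W \<sigma> \<tau> \<longleftrightarrow> (\<forall>x. x \<notin> W \<longrightarrow> nreg \<tau> x = nreg \<sigma> x \<and> narr \<tau> x = narr \<sigma> x \<and> rarr \<tau> x = rarr \<sigma> x)"

lemma frame_refl [simp]: "frame W \<sigma> \<sigma>"
  by (simp add: frame_def)

lemma exec_frame: "exec p \<sigma> t \<tau> \<Longrightarrow> frame (wr p) \<sigma> \<tau>"
  by (induction rule: exec.induct) (auto simp: frame_def)

lemma wp_frame: "wp p \<sigma> Q \<Longrightarrow> wp p \<sigma> (\<lambda>t \<tau>. Q t \<tau> \<and> frame (wr p) \<sigma> \<tau>)"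
  by (auto simp: wp_def dest: exec_frame)

lemma wp_conseq:
  "wp p \<sigma> Q \<Longrightarrow> (\<And>t \<tau>. Q t \<tau> \<Longrightarrow> frame (wr p) \<sigma> \<tau> \<Longrightarrow> Q' t \<tau>) \<Longrightarrow> wp p \<sigma> Q'"
  by (auto dest: wp_frame intro: wp_mono)

text \<open>Every loop test consumes time, so the time budget itself serves as the termination
  measure in \<open>wp_While\<close>.\<close>

lemma bcost_pos: "0 < bcost b"
  by (induction b) auto

text \<open>The invariant \<open>I v\<close> carries a budget \<open>v\<close> for the remaining running time of the loop.\<close>

lemma wp_While:
  fixes I :: "nat \<Rightarrow> state \<Rightarrow> bool"
  assumes init: "I v \<sigma>"
    and step: "\<And>v \<tau>. I v \<tau> \<Longrightarrow> frame (wr p) \<sigma> \<tau> \<Longrightarrow> bval b \<tau> \<Longrightarrow>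
      wp p \<tau> (\<lambda>t \<rho>. \<exists>v'. I v' \<rho> \<and> bcost b + t + v' \<le> v)"
    and exit: "\<And>v \<tau>. I v \<tau> \<Longrightarrow> \<not> bval b \<tau> \<Longrightarrow> bcost b \<le> v"
    and post: "\<And>t v' \<tau>. I v' \<tau> \<Longrightarrow> frame (wr p) \<sigma> \<tau> \<Longrightarrow> \<not> bval b \<tau> \<Longrightarrow> t \<le> v \<Longrightarrow> Q t \<tau>"
  shows "wp (While b p) \<sigma> Q"
proof -
  have "\<exists>t \<rho>. exec (While b p) \<tau> t \<rho> \<and> t \<le> v' \<and> \<not> bval b \<rho> \<and> frame (wr p) \<sigma> \<rho> \<and> (\<exists>u. I u \<rho>)"
    if "I v' \<tau>" "frame (wr p) \<sigma> \<tau>" for v' \<tau>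
    using that
  proof (induction v' arbitrary: \<tau> rule: less_induct)
    case (less v')
    show ?case
    proof (cases "bval b \<tau>")
      case True
      from step[OF less.prems True] obtain t \<rho> w where
        *: "exec p \<tau> t \<rho>" "I w \<rho>" "bcost b + t + w \<le> v'" unfolding wp_def by blast
      have "frame (wr p) \<sigma> \<rho>" using less.prems(2) exec_frame[OF *(1)] by (auto simp: frame_def)
      moreover have "w < v'" using *(3) bcost_pos[of b] by linarith
      ultimately obtain t' \<rho>' where **: "exec (While b p) \<rho> t' \<rho>'" "t' \<le> w" "\<not> bval b \<rho>'"
        "frame (wr p) \<sigma> \<rho>'" "\<exists>u. I u \<rho>'" using less.IH[of w \<rho>] *(2) by blast
      have "exec (While b p) \<tau> (bcost b + t + t') \<rho>'"
        using True *(1) **(1) by (rule exec.WhileTrue)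
      moreover have "bcost b + t + t' \<le> v'" using *(3) **(2) by linarith
      ultimately show ?thesis using ** by blast
    next
      case False
      then show ?thesis using less.prems exit exec.WhileFalse by blast
    qed
  qed
  from this[OF init frame_refl] obtain t \<rho> u where
    "exec (While b p) \<sigma> t \<rho>" "t \<le> v" "\<not> bval b \<rho>" "frame (wr p) \<sigma> \<rho>" "I u \<rho>" by blast
  with post[of u \<rho> t] show ?thesis unfolding wp_def by blast
qed

text \<open>The main loop is charged to a real-valued potential, so budgets are rounded down to
  naturals. Assumption \<open>pos\<close> keeps them nonnegative in every reachable state, where
  \<open>nat\<close> of the floor respects the inequality.\<close>

lemma wp_While_real:
  fixes I :: "real \<Rightarrow> state \<Rightarrow> bool"
  assumes init: "I v \<sigma>"
    and step: "\<And>v \<tau>. I v \<tau> \<Longrightarrow> frame (wr p) \<sigma> \<tau> \<Longrightarrow> bval b \<tau> \<Longrightarrow>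
      wp p \<tau> (\<lambda>t \<rho>. \<exists>v'. I v' \<rho> \<and> real (bcost b + t) + v' \<le> v)"
    and pos: "\<And>v \<tau>. I v \<tau> \<Longrightarrow> real (bcost b) \<le> v"
    and post: "\<And>t v' \<tau>. I v' \<tau> \<Longrightarrow> frame (wr p) \<sigma> \<tau> \<Longrightarrow> \<not> bval b \<tau> \<Longrightarrow> real t \<le> v \<Longrightarrow> Q t \<tau>"
  shows "wp (While b p) \<sigma> Q"
proof (rule wp_While[where I = "\<lambda>n \<tau>. \<exists>u. I u \<tau> \<and> n = nat \<lfloor>u\<rfloor>" and v = "nat \<lfloor>v\<rfloor>"])
  show "\<exists>u. I u \<sigma> \<and> nat \<lfloor>v\<rfloor> = nat \<lfloor>u\<rfloor>" using init by blast
next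
  fix n \<tau> assume "\<exists>u. I u \<tau> \<and> n = nat \<lfloor>u\<rfloor>" and F: "frame (wr p) \<sigma> \<tau>" "bval b \<tau>"
  then obtain u where u: "I u \<tau>" "n = nat \<lfloor>u\<rfloor>" by blast
  show "wp p \<tau> (\<lambda>t \<rho>. \<exists>v'. (\<exists>u. I u \<rho> \<and> v' = nat \<lfloor>u\<rfloor>) \<and> bcost b + t + v' \<le> n)"
  proof (rule wp_mono[OF step[OF u(1) F]])
    fix t \<rho> assume "\<exists>v'. I v' \<rho> \<and> real (bcost b + t) + v' \<le> u"
    then obtain v' where v': "I v' \<rho>" "real (bcost b + t) + v' \<le> u" by blast
    have "v' \<ge> 0" using pos[OF v'(1)] by linarith
    then have "bcost b + t + nat \<lfloor>v'\<rfloor> \<le> n" using v'(2) u(2) by linarith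
    then show "\<exists>v'. (\<exists>u. I u \<rho> \<and> v' = nat \<lfloor>u\<rfloor>) \<and> bcost b + t + v' \<le> n" using v'(1) by blast
  qed
next
  fix n \<tau> assume "\<exists>u. I u \<tau> \<and> n = nat \<lfloor>u\<rfloor>"
  then obtain u where "I u \<tau>" "n = nat \<lfloor>u\<rfloor>" by blast
  then show "bcost b \<le> n" using pos[of u \<tau>] by linarith
next
  fix t v' \<tau>
  assume "\<exists>u. I u \<tau> \<and> v' = nat \<lfloor>u\<rfloor>" "frame (wr p) \<sigma> \<tau>" "\<not> bval b \<tau>" "t \<le> nat \<lfloor>v\<rfloor>"
  moreover have "0 \<le> v" using pos[OF init] by linarith
  ultimately show "Q t \<tau>" using post[of _ \<tau> t] by (auto simp: le_nat_iff le_floor_iff)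
qed

section \<open>Frame rules and the effect of updates on registers, arrays and lists\<close>

lemma frame_nreg: "frame W \<sigma> \<tau> \<Longrightarrow> x \<notin> W \<Longrightarrow> nreg \<tau> x = nreg \<sigma> x"
  and frame_narr: "frame W \<sigma> \<tau> \<Longrightarrow> x \<notin> W \<Longrightarrow> narr \<tau> x = narr \<sigma> x"
  and frame_rarr: "frame W \<sigma> \<tau> \<Longrightarrow> x \<notin> W \<Longrightarrow> rarr \<tau> x = rarr \<sigma> x"
  and frame_lst: "frame W \<sigma> \<tau> \<Longrightarrow> x \<notin> W \<Longrightarrow> lst x \<tau> = lst x \<sigma>"
  by (auto simp: frame_def lst_def)

lemmas frame_simps = frame_nreg frame_narr frame_rarr frame_lst

lemma nreg_setN [simp]: "nreg (setN x v \<sigma>) y = (if y = x then v else nreg \<sigma> y)"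
  and narr_setN [simp]: "narr (setN x v \<sigma>) = narr \<sigma>"
  and rarr_setN [simp]: "rarr (setN x v \<sigma>) = rarr \<sigma>"
  and nreg_setR [simp]: "nreg (setR a i r \<sigma>) = nreg \<sigma>"
  and narr_setR [simp]: "narr (setR a i r \<sigma>) = narr \<sigma>"
  and rarr_setR [simp]: "rarr (setR a i r \<sigma>) = (rarr \<sigma>)(a := (rarr \<sigma> a)(i := r))"
  and nreg_push [simp]: "nreg (push x v \<sigma>) y = (if y = x then nreg \<sigma> y + 1 else nreg \<sigma> y)"
  and rarr_push [simp]: "rarr (push x v \<sigma>) = rarr \<sigma>"
  and narr_push [simp]: "y \<noteq> x \<Longrightarrow> narr (push x v \<sigma>) y = narr \<sigma> y"
  by (auto simp: setN_def setR_def push_def)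

lemma lst_setN [simp]: "x \<noteq> y \<Longrightarrow> lst y (setN x v \<sigma>) = lst y \<sigma>"
  and lst_clear [simp]: "lst x (setN x 0 \<sigma>) = []"
  and lst_setR [simp]: "lst y (setR a i r \<sigma>) = lst y \<sigma>"
  and lst_pop [simp]: "v \<le> nreg \<sigma> x \<Longrightarrow> lst x (setN x v \<sigma>) = take v (lst x \<sigma>)"
  and lst_push [simp]: "lst y (push x v \<sigma>) = (if x = y then lst y \<sigma> @ [v] else lst y \<sigma>)"
  by (auto simp: lst_def setN_def setR_def push_def take_map)

lemma length_lst: "nreg \<sigma> x = length (lst x \<sigma>)"
  by (simp add: lst_def)

lemma narr_lst: "i < length (lst x \<sigma>) \<Longrightarrow> narr \<sigma> x i = lst x \<sigma> ! i"
  by (simp add: lst_def)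

lemma wp_While_measure:
  fixes V :: "state \<Rightarrow> nat"
  assumes "I \<sigma>"
    and "\<And>\<tau>. I \<tau> \<Longrightarrow> frame (wr p) \<sigma> \<tau> \<Longrightarrow> bval b \<tau> \<Longrightarrow>
      wp p \<tau> (\<lambda>t \<rho>. I \<rho> \<and> bcost b + t + V \<rho> \<le> V \<tau>)"
    and "\<And>\<tau>. I \<tau> \<Longrightarrow> \<not> bval b \<tau> \<Longrightarrow> bcost b \<le> V \<tau>"
    and "\<And>t \<tau>. I \<tau> \<Longrightarrow> frame (wr p) \<sigma> \<tau> \<Longrightarrow> \<not> bval b \<tau> \<Longrightarrow> t \<le> V \<sigma> \<Longrightarrow> Q t \<tau>"
  shows "wp (While b p) \<sigma> Q"
  using assms by (intro wp_While[where I = "\<lambda>v \<tau>. I \<tau> \<and> v = V \<tau>" and v = "V \<sigma>"]) auto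

section \<open>Sorting\<close>

fun merge :: "('a \<Rightarrow> 'a \<Rightarrow> bool) \<Rightarrow> 'a list \<Rightarrow> 'a list \<Rightarrow> 'a list" where
  "merge le [] ys = ys"
| "merge le xs [] = xs"
| "merge le (x # xs) (y # ys) = (if le x y then x # merge le xs (y # ys) else y # merge le (x # xs) ys)"

lemma merge_Nil2 [simp]: "merge le xs [] = xs"
  by (cases xs) auto

lemma mset_merge [simp]: "mset (merge le xs ys) = mset xs + mset ys"
  by (induction le xs ys rule: merge.induct) auto

lemma set_merge [simp]: "set (merge le xs ys) = set xs \<union> set ys"
  by (metis mset_merge set_mset_mset set_mset_union)

lemma length_merge [simp]: "length (merge le xs ys) = length xs + length ys"
  by (metis mset_merge size_mset size_union)

lemma sorted_merge:
  assumes "\<And>x y. le x y \<or> le y x" "\<And>x y z. le x y \<Longrightarrow> le y z \<Longrightarrow> le x z"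
  shows "sorted_wrt le xs \<Longrightarrow> sorted_wrt le ys \<Longrightarrow> sorted_wrt le (merge le xs ys)"
  using assms
proof (induction le xs ys rule: merge.induct)
  case (3 le x xs y ys)
  note le = "3.prems"(3,4)
  show ?case
  proof (cases "le x y")
    case True
    then have "le x z" if "z \<in> set xs \<union> set (y # ys)" for z
      using that "3.prems"(1,2) le(2)[of x y z] by auto
    then show ?thesis using 3(1)[OF True _ _ "3.prems"(3,4)] "3.prems"(1,2) True by simp
  next
    case False
    then have "le y z" if "z \<in> set (x # xs) \<union> set ys" for z
      using that "3.prems"(1,2) le(1)[of x y] le(2)[of y x z] by auto
    then show ?thesis using 3(2)[OF False _ _ "3.prems"(3,4)] "3.prems"(1,2) False by simp
  qed
qed auto

text \<open>One round of bottom-up merge sort. This variant needs no recursion, which the machine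
  language does not offer.\<close>

function pass :: "('a \<Rightarrow> 'a \<Rightarrow> bool) \<Rightarrow> nat \<Rightarrow> 'a list \<Rightarrow> 'a list" where
  "pass le w xs = (if w = 0 \<or> xs = [] then xs
     else merge le (take w xs) (take w (drop w xs)) @ pass le w (drop w (drop w xs)))"
  by pat_completeness auto
termination by (relation "measure (\<lambda>(_, _, xs). length xs)") auto

text \<open>The invariant between the rounds; the last block may be shorter than
  \<open>w\<close>.\<close>

function runs :: "('a \<Rightarrow> 'a \<Rightarrow> bool) \<Rightarrow> nat \<Rightarrow> 'a list \<Rightarrow> bool" where
  "runs le w xs = (if w = 0 \<or> xs = [] then True
     else sorted_wrt le (take w xs) \<and> runs le w (drop w xs))"
  by pat_completeness auto
termination by (relation "measure (\<lambda>(_, _, xs). length xs)") auto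

declare pass.simps [simp del] runs.simps [simp del]

lemma pass_Nil [simp]: "pass le w [] = []"
  by (subst pass.simps) simp

lemma runs_Nil [simp]: "runs le w []"
  by (subst runs.simps) simp

lemma runs_step:
  "w \<noteq> 0 \<Longrightarrow> xs \<noteq> [] \<Longrightarrow> runs le w xs \<longleftrightarrow> sorted_wrt le (take w xs) \<and> runs le w (drop w xs)"
  by (subst runs.simps) simp

lemma mset_pass [simp]: "mset (pass le w xs) = mset xs"
proof (induction le w xs rule: pass.induct)
  case (1 le w xs)
  show ?case
  proof (cases "w = 0 \<or> xs = []")
    case False
    then have "mset (pass le w xs) = mset (take w xs @ take w (drop w xs) @ drop w (drop w xs))"
      using 1 by (subst pass.simps) simp
    also have "\<dots> = mset xs" by (simp only: append_take_drop_id)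
    finally show ?thesis .
  qed (subst pass.simps; simp)
qed

lemma length_pass [simp]: "length (pass le w xs) = length xs"
  by (metis mset_pass size_mset)

lemma runs_pass:
  assumes "\<And>x y. le x y \<or> le y x" "\<And>x y z. le x y \<Longrightarrow> le y z \<Longrightarrow> le x z"
  shows "runs le w xs \<Longrightarrow> runs le (w + w) (pass le w xs)"
proof (induction "length xs" arbitrary: xs rule: less_induct)
  case less
  show ?case
  proof (cases "w = 0 \<or> xs = []")
    case False
    let ?m = "merge le (take w xs) (take w (drop w xs))" and ?r = "drop w (drop w xs)"
    have runs: "sorted_wrt le (take w xs)" "runs le w (drop w xs)"
      using less.prems False runs_step[of w xs le] by auto
    have "sorted_wrt le (take w (drop w xs))" "runs le w ?r"
      using runs(2) False runs_step[of w "drop w xs" le]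
      by (cases "drop w xs = []", simp_all del: drop_eq_Nil drop_drop)+
    have m: "sorted_wrt le ?m"
      by (rule sorted_merge) (fact runs \<open>sorted_wrt le (take w (drop w xs))\<close> | erule (1) assms(2) | rule assms(1))+
    have IH: "runs le (w + w) (pass le w ?r)"
      using less.hyps[of ?r] False \<open>runs le w ?r\<close> by auto
    have eq: "pass le w xs = ?m @ pass le w ?r"
      using False by (subst pass.simps) simp
    \<comment> \<open>Only the last merged block can be short, and then nothing follows it, so
      cutting at \<open>w + w\<close> always separates \<open>?m\<close> from the rest.\<close>
    have "length ?m = w + w \<or> ?r = [] \<and> length ?m \<le> w + w"
      by (auto simp: min_def)
    then have "take (w + w) (pass le w xs) = ?m \<and> drop (w + w) (pass le w xs) = pass le w ?r"
      unfolding eq by auto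
    then show ?thesis using m IH False runs_step[of "w + w" "pass le w xs" le]
      by (cases "pass le w xs = []") auto
  next
    case True
    then have "pass le w xs = xs" by (subst pass.simps) simp
    then show ?thesis using True by (subst runs.simps) auto
  qed
qed

lemma runs_1: "runs le 1 xs"
proof (induction xs)
  case (Cons x xs)
  then show ?case by (subst runs.simps) simp
qed (subst runs.simps; simp)

lemma runs_sorted: "runs le w xs \<Longrightarrow> 0 < w \<Longrightarrow> length xs \<le> w \<Longrightarrow> sorted_wrt le xs"
  by (subst (asm) runs.simps) (auto split: if_splits)

definition slice :: "'a list \<Rightarrow> nat \<Rightarrow> nat \<Rightarrow> 'a list" where
  "slice xs p q = take (q - p) (drop p xs)"

lemma slice_empty [simp]: "q \<le> p \<Longrightarrow> slice xs p q = []"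
  by (simp add: slice_def)

lemma slice_Cons: "p < q \<Longrightarrow> p < length xs \<Longrightarrow> slice xs p q = xs ! p # slice xs (Suc p) q"
  unfolding slice_def by (subst Cons_nth_drop_Suc[symmetric]) (auto simp: take_Cons')

section \<open>Bottom-up merge sort as a program\<close>

definition NMin :: "nexp \<Rightarrow> nexp \<Rightarrow> nexp" where
  "NMin e f = NSub e (NSub e f)"

lemma nval_NMin [simp]: "nval (NMin e f) \<sigma> = min (nval e \<sigma>) (nval f \<sigma>)"
  and ncost_NMin [simp]: "ncost (NMin e f) = 2 * ncost e + ncost f + 2"
  by (simp_all add: NMin_def)

text \<open>After \<open>Setup\<close> the array \<open>A\<close> contains the vectors of both sets,
  and \<open>o\<close> lists their start addresses in place of a multiplication.\<close>

definition Co :: "nexp \<Rightarrow> nexp \<Rightarrow> rexp" where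
  "Co x k = RArr ''A'' (NAdd (NArr ''o'' x) k)"

text \<open>Equality of coordinates is the failure of both strict comparisons; in a tie, only a
  point of A is greater than a point of B.\<close>

definition Greater :: "nexp \<Rightarrow> nexp \<Rightarrow> bexp" where
  "Greater x y = Conj (Neg (RLess (Co x (NReg ''k'')) (Co y (NReg ''k''))))
     (Neg (Conj (Neg (RLess (Co y (NReg ''k'')) (Co x (NReg ''k''))))
       (Neg (Conj (NLess x (NReg ''sizeA'')) (Neg (NLess y (NReg ''sizeA'')))))))"

definition Merge :: com where
  "Merge = While (Neg (Conj (Neg (NLess (NReg ''p'') (NReg ''e''))) (Neg (NLess (NReg ''q'') (NReg ''g'')))))
    (Cond (Conj (NLess (NReg ''p'') (NReg ''e''))
        (Neg (Conj (NLess (NReg ''q'') (NReg ''g'')) (Greater (NArr ''X'' (NReg ''p'')) (NArr ''X'' (NReg ''q''))))))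
      (Push ''W'' (NArr ''X'' (NReg ''p'')) ;; NAssign ''p'' (NAdd (NReg ''p'') (NConst 1)))
      (Push ''W'' (NArr ''X'' (NReg ''q'')) ;; NAssign ''q'' (NAdd (NReg ''q'') (NConst 1))))"

definition Pass :: com where
  "Pass = (
    NAssign ''W'' (NConst 0) ;; NAssign ''f'' (NConst 0) ;;
    While (NLess (NReg ''f'') (NReg ''X'')) (
      NAssign ''p'' (NReg ''f'') ;;
      NAssign ''e'' (NAdd (NReg ''f'') (NReg ''w'')) ;;
      NAssign ''e'' (NMin (NReg ''e'') (NReg ''X'')) ;;
      NAssign ''q'' (NReg ''e'') ;;
      NAssign ''g'' (NAdd (NReg ''e'') (NReg ''w'')) ;;
      NAssign ''g'' (NMin (NReg ''g'') (NReg ''X'')) ;;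
      Merge ;; NAssign ''f'' (NReg ''g'')))"

definition Copy :: com where
  "Copy = (NAssign ''X'' (NConst 0) ;;
    While (NLess (NReg ''X'') (NReg ''W'')) (Push ''X'' (NArr ''W'' (NReg ''X''))))"

definition Sort :: com where
  "Sort = (NAssign ''w'' (NConst 1) ;;
    While (NLess (NReg ''w'') (NReg ''X'')) (Pass ;; Copy ;; NAssign ''w'' (NAdd (NReg ''w'') (NReg ''w''))))"

lemma wr_Merge [simp]: "wr Merge = {''W'', ''p'', ''q''}"
  by (auto simp: Merge_def)

lemma wr_Pass [simp]: "wr Pass = {''W'', ''f'', ''p'', ''e'', ''q'', ''g''}"
  by (auto simp: Pass_def)

lemma wr_Copy [simp]: "wr Copy = {''X''}"
  by (auto simp: Copy_def)

lemma wr_Sort [simp]: "wr Sort = {''X'', ''W'', ''f'', ''p'', ''e'', ''q'', ''g'', ''w''}"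
  by (auto simp: Sort_def)

text \<open>
  The points of both sets are numbered consecutively: \<open>x < nA\<close> is a point of \<open>A\<close>, and
  \<open>nA \<le> x < n\<close> a point of \<open>B\<close>. Coordinate \<open>k\<close> of point \<open>x\<close> is \<open>cd x k\<close>.
\<close>

locale points =
  fixes nA n d :: nat and cd :: "nat \<Rightarrow> nat \<Rightarrow> real"
begin

definition layout :: "state \<Rightarrow> bool" where
  "layout \<sigma> \<longleftrightarrow> nreg \<sigma> ''sizeA'' = nA \<and> nreg \<sigma> ''dim'' = d \<and>
    (\<forall>x<n. \<forall>k<d. rarr \<sigma> ''A'' (narr \<sigma> ''o'' x + k) = cd x k)"

lemma layout_frame:
  assumes "frame W \<sigma> \<tau>" "layout \<sigma>" "W \<inter> {''sizeA'', ''dim'', ''A'', ''o''} = {}"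
  shows "layout \<tau>"
proof -
  have "''sizeA'' \<notin> W" "''dim'' \<notin> W" "''A'' \<notin> W" "''o'' \<notin> W" using assms(3) by blast+
  then show ?thesis using assms(1,2) by (simp add: layout_def frame_simps)
qed

lemma layout_setN [simp]: "x \<noteq> ''sizeA'' \<Longrightarrow> x \<noteq> ''dim'' \<Longrightarrow> layout (setN x v \<sigma>) = layout \<sigma>"
  and layout_push [simp]: "x \<noteq> ''sizeA'' \<Longrightarrow> x \<noteq> ''dim'' \<Longrightarrow> x \<noteq> ''o'' \<Longrightarrow> layout (push x v \<sigma>) = layout \<sigma>"
  by (simp_all add: layout_def)

text \<open>Among points with equal coordinate, those of \<open>B\<close> come first, since \<open>u \<ge> v\<close> is not strict.\<close>

definition le :: "nat \<Rightarrow> nat \<Rightarrow> nat \<Rightarrow> bool" where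
  "le k x y \<longleftrightarrow> cd x k < cd y k \<or> cd x k = cd y k \<and> (nA \<le> x \<or> y < nA)"

lemma le_total: "le k x y \<or> le k y x"
  and le_trans: "le k x y \<Longrightarrow> le k y z \<Longrightarrow> le k x z"
  by (auto simp: le_def)

lemma bval_Greater:
  assumes "layout \<sigma>" "nval x \<sigma> < n" "nval y \<sigma> < n" "nreg \<sigma> ''k'' < d"
  shows "bval (Greater x y) \<sigma> \<longleftrightarrow> \<not> le (nreg \<sigma> ''k'') (nval x \<sigma>) (nval y \<sigma>)"
  using assms by (auto simp: Greater_def Co_def le_def layout_def)

lemma wp_Merge:
  assumes "layout \<sigma>" "nreg \<sigma> ''k'' < d" "\<forall>x \<in> set (lst ''X'' \<sigma>). x < n"
    "nreg \<sigma> ''e'' \<le> length (lst ''X'' \<sigma>)" "nreg \<sigma> ''g'' \<le> length (lst ''X'' \<sigma>)"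
  shows "wp Merge \<sigma> (\<lambda>t \<tau>. lst ''W'' \<tau> = lst ''W'' \<sigma> @
      merge (le (nreg \<sigma> ''k'')) (slice (lst ''X'' \<sigma>) (nreg \<sigma> ''p'') (nreg \<sigma> ''e''))
        (slice (lst ''X'' \<sigma>) (nreg \<sigma> ''q'') (nreg \<sigma> ''g'')) \<and>
      t \<le> 100 * ((nreg \<sigma> ''e'' - nreg \<sigma> ''p'') + (nreg \<sigma> ''g'' - nreg \<sigma> ''q'')) + 10)"
proof -
  define k L e g where "k = nreg \<sigma> ''k''" "L = lst ''X'' \<sigma>" "e = nreg \<sigma> ''e''" "g = nreg \<sigma> ''g''"
  note defs = this
  let ?M = "\<lambda>\<tau>. merge (le k) (slice L (nreg \<tau> ''p'') e) (slice L (nreg \<tau> ''q'') g)"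
  show ?thesis
    unfolding Merge_def
  proof (rule wp_While_measure[where I = "\<lambda>\<tau>. lst ''W'' \<tau> @ ?M \<tau> = lst ''W'' \<sigma> @ ?M \<sigma>"
      and V = "\<lambda>\<tau>. 100 * ((e - nreg \<tau> ''p'') + (g - nreg \<tau> ''q'')) + 10"], goal_cases)
    case 1
    then show ?case by simp
  next
    case (2 \<tau>)
    have fr: "nreg \<tau> ''e'' = e" "nreg \<tau> ''g'' = g" "nreg \<tau> ''k'' = k" "lst ''X'' \<tau> = L"
      using frame_simps[OF 2(2)] by (simp_all add: defs)
    have lay: "layout \<tau>" using layout_frame[OF 2(2) assms(1)] by simp
    define p q where "p = nreg \<tau> ''p''" "q = nreg \<tau> ''q''"
    note pq = this
    have b: "p < e \<or> q < g" using 2(3) by (auto simp: fr pq)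
    have X: "i < length L \<Longrightarrow> narr \<tau> ''X'' i = L ! i" for i using narr_lst[of i "''X''" \<tau>] fr by simp
    have len: "e \<le> length L" "g \<le> length L" using assms by (simp_all add: defs)
    have gr: "bval (Greater (NArr ''X'' (NReg ''p'')) (NArr ''X'' (NReg ''q''))) \<tau> \<longleftrightarrow> \<not> le k (L ! p) (L ! q)"
      if "p < e" "q < g"
      using that len assms(2,3) by (subst bval_Greater) (auto simp: fr X lay defs(1,2) pq[symmetric])
    have cost: "bcost (Greater (NArr ''X'' (NReg ''p'')) (NArr ''X'' (NReg ''q''))) = 42"
      by (simp add: Greater_def Co_def)
    show ?case
    proof (cases "p < e \<and> (q < g \<longrightarrow> le k (L ! p) (L ! q))")
      case True
      then have "merge (le k) (slice L p e) (slice L q g) = L ! p # merge (le k) (slice L (Suc p) e) (slice L q g)"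
        using len by (cases "q < g") (auto simp: slice_Cons)
      then show ?thesis using True 2(1) len gr by (auto simp: fr X cost pq)
    next
      case False
      then have "q < g" "p < e \<Longrightarrow> \<not> le k (L ! p) (L ! q)" using b by auto
      moreover from this have "merge (le k) (slice L p e) (slice L q g) = L ! q # merge (le k) (slice L p e) (slice L (Suc q) g)"
        using len by (cases "p < e") (auto simp: slice_Cons)
      ultimately show ?thesis using 2(1) len gr by (auto simp: fr X cost pq)
    qed
  next
    case (3 \<tau>)
    then show ?case by simp
  next
    case (4 t \<tau>)
    have fr: "nreg \<tau> ''e'' = e" "nreg \<tau> ''g'' = g"
      using frame_simps[OF 4(2)] by (simp_all add: defs)
    have "?M \<tau> = []" using 4(3) by (simp add: fr)
    then show ?case using 4(1,4) by (simp add: defs)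
  qed
qed


lemma wp_Pass:
  assumes "layout \<sigma>" "nreg \<sigma> ''k'' < d" "\<forall>x \<in> set (lst ''X'' \<sigma>). x < n" "0 < nreg \<sigma> ''w''"
  shows "wp Pass \<sigma> (\<lambda>t \<tau>. lst ''W'' \<tau> = pass (le (nreg \<sigma> ''k'')) (nreg \<sigma> ''w'') (lst ''X'' \<sigma>) \<and>
      t \<le> 200 * length (lst ''X'' \<sigma>) + 20)"
proof -
  define k L w where "k = nreg \<sigma> ''k''" "L = lst ''X'' \<sigma>" "w = nreg \<sigma> ''w''"
  note defs = this
  have w: "0 < w" using assms by (simp add: defs)
  let ?\<sigma> = "setN ''f'' 0 (setN ''W'' 0 \<sigma>)"
  have X0: "nreg \<sigma> ''X'' = length L" using length_lst[of \<sigma> "''X''"] by (simp add: defs)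
  show ?thesis
    unfolding Pass_def
    apply simp
  proof (rule wp_While_measure[where I = "\<lambda>\<tau>. lst ''W'' \<tau> @ pass (le k) w (drop (nreg \<tau> ''f'') L) = pass (le k) w L"
      and V = "\<lambda>\<tau>. 200 * (length L - nreg \<tau> ''f'') + 10"], goal_cases)
    case 1
    then show ?case by simp
  next
    case (2 \<tau>)
    have fr: "nreg \<tau> ''w'' = w" "nreg \<tau> ''k'' = k" "lst ''X'' \<tau> = L" "nreg \<tau> ''X'' = length L"
      using frame_simps[OF 2(2)] by (simp_all add: defs X0[unfolded defs])
    have lay: "layout \<tau>" using layout_frame[OF 2(2)] assms(1) by simp
    define f where "f = nreg \<tau> ''f''"
    have f: "f < length L" using 2(3) by (simp add: fr f_def)
    define e g where "e = min (f + w) (length L)" "g = min (e + w) (length L)"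
    note eg = this
    have fe: "f < e" "e \<le> g" "e \<le> length L" "g \<le> length L" using f w by (auto simp: eg)
    have s1: "slice L f e = take w (drop f L)" using f by (auto simp: slice_def eg min_def)
    have s2: "slice L e g = take w (drop w (drop f L))"
      using f by (auto simp: slice_def eg min_def add_ac)
    have s3: "drop g L = drop w (drop w (drop f L))"
      using f by (auto simp: eg min_def add_ac)
    have step: "pass (le k) w (drop f L) = merge (le k) (slice L f e) (slice L e g) @ pass (le k) w (drop g L)"
      using f w by (subst pass.simps) (simp add: s1 s2 s3)
    show ?case
      apply (simp add: fr f_def[symmetric] eg[symmetric])
      apply (rule wp_conseq[OF wp_Merge])
      subgoal using lay by simp
      subgoal using assms(2) by (simp add: fr defs)
      subgoal using assms(3) by (simp add: fr defs)
      subgoal using fe by (simp add: fr)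
      subgoal using fe by (simp add: fr)
      subgoal for t \<rho> 
        apply (frule frame_nreg[of _ _ _ "''g''"])
        using 2(1) fe f step by (auto simp: fr f_def[symmetric])
      done
  next
    case (3 \<tau>)
    then show ?case by simp
  next
    case (4 t \<tau>)
    have "length L \<le> nreg \<tau> ''f''" using 4(3) frame_nreg[OF 4(2), of "''X''"] by (simp add: X0)
    then show ?case using 4(1,4) by (simp add: defs)
  qed
qed

lemma wp_Copy: "wp Copy \<sigma> (\<lambda>t \<tau>. lst ''X'' \<tau> = lst ''W'' \<sigma> \<and> t \<le> 20 * length (lst ''W'' \<sigma>) + 20)"
proof -
  define L where "L = lst ''W'' \<sigma>"
  have W0: "nreg \<sigma> ''W'' = length L" using length_lst[of \<sigma> "''W''"] by (simp add: L_def)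
  show ?thesis
    unfolding Copy_def
    apply simp
  proof (rule wp_While_measure[where I = "\<lambda>\<tau>. nreg \<tau> ''X'' \<le> length L \<and> lst ''X'' \<tau> = take (nreg \<tau> ''X'') L"
      and V = "\<lambda>\<tau>. 20 * (length L - nreg \<tau> ''X'') + 10"], goal_cases)
    case 1
    then show ?case by simp
  next
    case (2 \<tau>)
    have fr: "lst ''W'' \<tau> = L" "nreg \<tau> ''W'' = length L"
      using frame_simps[OF 2(2)] by (simp_all add: L_def[symmetric] W0)
    have "nreg \<tau> ''X'' < length L" using 2(3) by (simp add: fr)
    moreover from this have "narr \<tau> ''W'' (nreg \<tau> ''X'') = L ! nreg \<tau> ''X''"
      using narr_lst[of _ "''W''" \<tau>] fr by simp
    ultimately show ?case using 2(1) by (simp add: take_Suc_conv_app_nth)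
  next
    case (3 \<tau>)
    then show ?case by simp
  next
    case (4 t \<tau>)
    then show ?case using frame_nreg[OF 4(2), of "''W''"] by (simp add: W0 L_def[symmetric])
  qed
qed

lemma runs_pass_le: "runs (le k) w xs \<Longrightarrow> runs (le k) (w + w) (pass (le k) w xs)"
  by (rule runs_pass) (use le_total le_trans in blast)+

text \<open>Every round doubles the width of the sorted runs, so \<open>r\<close> bounds the number
  of rounds.\<close>

lemma wp_Sort:
  assumes "layout \<sigma>" "nreg \<sigma> ''k'' < d" "\<forall>x \<in> set (lst ''X'' \<sigma>). x < n" "length (lst ''X'' \<sigma>) \<le> 2 ^ r"
  shows "wp Sort \<sigma> (\<lambda>t \<tau>. mset (lst ''X'' \<tau>) = mset (lst ''X'' \<sigma>) \<and>
      sorted_wrt (le (nreg \<sigma> ''k'')) (lst ''X'' \<tau>) \<and>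
      t \<le> (220 * length (lst ''X'' \<sigma>) + 60) * (r + 1))"
proof -
  define k L where "k = nreg \<sigma> ''k''" "L = lst ''X'' \<sigma>"
  note defs = this
  show ?thesis
    unfolding Sort_def
    apply simp
  proof (rule wp_While[where I = "\<lambda>v \<tau>. mset (lst ''X'' \<tau>) = mset L \<and> runs (le k) (nreg \<tau> ''w'') (lst ''X'' \<tau>) \<and>
       (\<exists>j\<le>r. nreg \<tau> ''w'' = 2 ^ j \<and> v = (220 * length L + 60) * (r - j) + 5)"
      and v = "(220 * length L + 60) * r + 5"], goal_cases)
    case 1
    then show ?case by (auto simp: defs runs_1[unfolded One_nat_def] intro!: exI[of _ 0])
  next
    case (2 v \<tau>)
    obtain j where j: "j \<le> r" "nreg \<tau> ''w'' = 2 ^ j" "v = (220 * length L + 60) * (r - j) + 5"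
      using 2(1) by blast
    have fr: "nreg \<tau> ''k'' = k"
      using frame_simps[OF 2(2)] by (simp_all add: defs)
    have lay: "layout \<tau>" using layout_frame[OF 2(2)] assms(1) by simp
    have M: "mset (lst ''X'' \<tau>) = mset L" and R: "runs (le k) (2 ^ j) (lst ''X'' \<tau>)"
      using 2(1) j by auto
    have S: "set (lst ''X'' \<tau>) = set L" and len: "length (lst ''X'' \<tau>) = length L"
      using M mset_eq_setD mset_eq_length by blast+
    have "2 ^ j < (2::nat) ^ r" using 2(3) j(2) assms(4) length_lst[of \<tau> "''X''"] len
      unfolding defs by (metis bval.simps(1) nval.simps(2) order_less_le_trans)
    then have "j < r" by (simp add: power_strict_increasing_iff)
    then obtain i where i: "r = Suc (j + i)" using less_imp_Suc_add by blast
    show ?case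
      apply simp
      apply (rule wp_conseq[OF wp_Pass])
      subgoal using lay by simp
      subgoal using assms(2) by (simp add: fr defs)
      subgoal using assms(3) by (simp add: S defs)
      subgoal using j by simp
      subgoal for t \<rho>
        apply (rule wp_conseq[OF wp_Copy])
        subgoal premises prems for t' \<rho>'
        proof -
          have w: "nreg \<rho>' ''w'' = 2 ^ j"
            using frame_nreg[OF prems(4), of "''w''"] frame_nreg[OF prems(2), of "''w''"] j by simp
          have L: "lst ''X'' \<rho>' = pass (le k) (2 ^ j) (lst ''X'' \<tau>)"
            and t: "t \<le> 200 * length L + 20" "t' \<le> 20 * length L + 20"
            using prems by (auto simp: fr j len)
          let ?v = "(220 * length L + 60) * (r - Suc j) + 5"
          have "7 + (t + t' + ?v) \<le> v" using t by (simp add: j i)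
          moreover have "\<exists>j\<le>r. nreg \<rho>' ''w'' + nreg \<rho>' ''w'' = 2 ^ j \<and> ?v = (220 * length L + 60) * (r - j) + 5"
            using \<open>j < r\<close> w by (intro exI[of _ "Suc j"]) auto
          moreover have "runs (le k) (nreg \<rho>' ''w'' + nreg \<rho>' ''w'') (lst ''X'' \<rho>')"
            using runs_pass_le[OF R] by (simp add: L w)
          ultimately show ?thesis using M unfolding L by auto
        qed
        done
      done
  next
    case (3 v \<tau>)
    then show ?case by auto
  next
    case (4 t v' \<tau>)
    then have "length (lst ''X'' \<tau>) = length L" "0 < nreg \<tau> ''w''" using mset_eq_length by auto
    then have "sorted_wrt (le k) (lst ''X'' \<tau>)"
      using 4(1,3) by (auto simp: length_lst intro!: runs_sorted[of _ "nreg \<tau> ''w''"])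
    then show ?case using 4 by (simp add: defs)
  qed
qed

end

section \<open>Processing one subproblem\<close>

definition incr :: "name \<Rightarrow> com" where
  "incr x = NAssign x (NAdd (NReg x) (NConst 1))"

lemma wp_incr [simp]: "wp (incr x) \<sigma> Q \<longleftrightarrow> Q 4 (setN x (nreg \<sigma> x + 1) \<sigma>)"
  by (simp add: incr_def eval_nat_numeral)

lemma wr_incr [simp]: "wr (incr x) = {x}"
  by (simp add: incr_def)

text \<open>
  In \<open>Product\<close> and \<open>Cross\<close>, \<open>h\<close> is half of the total weight, where a point of \<open>A\<close> weighs \<open>mm\<close> and a
  point of \<open>B\<close> weighs \<open>nn\<close>.
\<close>

definition Pop :: com where
  "Pop = (
    NAssign ''k'' (NArr ''S'' (NSub (NReg ''S'') (NConst 1))) ;;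
    NAssign ''l'' (NArr ''S'' (NSub (NReg ''S'') (NConst 2))) ;;
    NAssign ''S'' (NSub (NReg ''S'') (NConst 2)) ;;
    NAssign ''X'' (NConst 0) ;;
    While (NLess (NConst 0) (NReg ''l'')) (
      Push ''X'' (NArr ''S'' (NSub (NReg ''S'') (NConst 1))) ;;
      NAssign ''S'' (NSub (NReg ''S'') (NConst 1)) ;;
      NAssign ''l'' (NSub (NReg ''l'') (NConst 1))))"

text \<open>Besides the sizes, one point of each set is remembered in \<open>u\<close> and
  \<open>v\<close>: once no coordinate is left, any such pair is an answer. \<open>v\<close> is
  already a position in B.\<close>

definition Count :: com where
  "Count = (
    NAssign ''nn'' (NConst 0) ;; NAssign ''mm'' (NConst 0) ;; NAssign ''b'' (NConst 0) ;;
    While (NLess (NReg ''b'') (NReg ''X'')) (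
      Cond (NLess (NArr ''X'' (NReg ''b'')) (NReg ''sizeA''))
        (incr ''nn'' ;; NAssign ''u'' (NArr ''X'' (NReg ''b'')))
        (incr ''mm'' ;; NAssign ''v'' (NSub (NArr ''X'' (NReg ''b'')) (NReg ''sizeA''))) ;;
      incr ''b''))"

text \<open>Multiplication by repeated addition; a linear number of additions is within the budget
  of a subproblem.\<close>

definition Product :: com where
  "Product = (
    NAssign ''h'' (NConst 0) ;; NAssign ''c'' (NReg ''nn'') ;;
    While (NLess (NConst 0) (NReg ''c'')) (
      NAssign ''h'' (NAdd (NReg ''h'') (NReg ''mm'')) ;;
      NAssign ''c'' (NSub (NReg ''c'') (NConst 1))))"

text \<open>The loop stops one position past the point that reaches the threshold, whence the final
  decrement.\<close>

definition Cross :: com where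
  "Cross = (
    NAssign ''a'' (NConst 0) ;; NAssign ''p'' (NConst 0) ;;
    While (NLess (NReg ''a'') (NReg ''h'')) (
      Cond (NLess (NArr ''X'' (NReg ''p'')) (NReg ''sizeA''))
        (NAssign ''a'' (NAdd (NReg ''a'') (NReg ''mm'')))
        (NAssign ''a'' (NAdd (NReg ''a'') (NReg ''nn''))) ;;
      incr ''p'') ;;
    NAssign ''p'' (NSub (NReg ''p'') (NConst 1)) ;;
    NAssign ''x'' (NArr ''X'' (NReg ''p'')))"

text \<open>\<open>Conj\<close> always evaluates both sides, so at the end a value at coordinate
  \<open>dim\<close> is read. Its content does not matter, because the first conjunct is already
  false.\<close>

definition Compare :: com where
  "Compare = (
    NAssign ''c'' (NConst 0) ;;
    While (Conj (NLess (NReg ''c'') (NReg ''dim''))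
        (Neg (RLess (Co (NReg ''u'') (NReg ''c'')) (Co (NReg ''v'') (NReg ''c'')))))
      (incr ''c''))"

text \<open>Points from the pivot's own set, and the pivot itself, also go through
  \<open>Compare\<close>; the test for \<open>u\<close> in A and \<open>v\<close> in B rejects
  them.\<close>

definition Brute :: com where
  "Brute = (
    NAssign ''b'' (NConst 0) ;;
    While (NLess (NReg ''b'') (NReg ''X'')) (
      Cond (NLess (NArr ''X'' (NReg ''b'')) (NReg ''sizeA''))
        (NAssign ''u'' (NArr ''X'' (NReg ''b'')) ;; NAssign ''v'' (NReg ''x''))
        (NAssign ''u'' (NReg ''x'') ;; NAssign ''v'' (NArr ''X'' (NReg ''b''))) ;;
      Compare ;;
      Cond (Conj (Neg (NLess (NReg ''c'') (NReg ''dim'')))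
            (Conj (NLess (NReg ''u'') (NReg ''sizeA'')) (Neg (NLess (NReg ''v'') (NReg ''sizeA'')))))
        (NAssign ''found'' (NConst 1) ;; NAssign ''i'' (NReg ''u'') ;;
          NAssign ''j'' (NSub (NReg ''v'') (NReg ''sizeA'')))
        Skip ;;
      incr ''b''))"

definition Part :: "bexp \<Rightarrow> bexp \<Rightarrow> nexp \<Rightarrow> com" where
  "Part bA bB e = (
    NAssign ''c'' (NConst 0) ;; NAssign ''b'' (NConst 0) ;;
    While (NLess (NReg ''b'') (NReg ''X'')) (
      Cond (NLess (NArr ''X'' (NReg ''b'')) (NReg ''sizeA''))
        (Cond bA (Push ''S'' (NArr ''X'' (NReg ''b'')) ;; incr ''c'') Skip)
        (Cond bB (Push ''S'' (NArr ''X'' (NReg ''b'')) ;; incr ''c'') Skip) ;;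
      incr ''b'') ;;
    Push ''S'' (NReg ''c'') ;; Push ''S'' e)"

lemma wr_Pop [simp]: "wr Pop = {''k'', ''l'', ''S'', ''X''}"
  and wr_Count [simp]: "wr Count = {''nn'', ''mm'', ''b'', ''u'', ''v''}"
  and wr_Product [simp]: "wr Product = {''h'', ''c''}"
  and wr_Cross [simp]: "wr Cross = {''a'', ''p'', ''x''}"
  and wr_Compare [simp]: "wr Compare = {''c''}"
  and wr_Brute [simp]: "wr Brute = {''b'', ''u'', ''v'', ''c'', ''found'', ''i'', ''j''}"
  and wr_Part [simp]: "wr (Part bA bB e) = {''c'', ''b'', ''S''}"
  by (auto simp: Pop_def Count_def Product_def Cross_def Compare_def Brute_def Part_def)

text \<open>The points come off the stack in reverse order, which is harmless since they are sorted
  afterwards.\<close>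

lemma wp_Pop:
  assumes "lst ''S'' \<sigma> = ss @ xs @ [length xs, k]"
  shows "wp Pop \<sigma> (\<lambda>t \<tau>. lst ''S'' \<tau> = ss \<and> lst ''X'' \<tau> = rev xs \<and> nreg \<tau> ''k'' = k \<and>
    t \<le> 40 * length xs + 40)"
proof -
  have S: "nreg \<sigma> ''S'' = length ss + length xs + 2" using length_lst[of \<sigma> "''S''"] assms by simp
  have S': "narr \<sigma> ''S'' (length ss + length xs + 1) = k" "narr \<sigma> ''S'' (length ss + length xs) = length xs"
    using assms by (auto simp: narr_lst nth_append)
  show ?thesis
    unfolding Pop_def
    apply (simp add: S S'[unfolded One_nat_def, simplified])
  proof (rule wp_While_measure[where I = "\<lambda>\<tau>. nreg \<tau> ''l'' \<le> length xs \<and> lst ''S'' \<tau> = ss @ take (nreg \<tau> ''l'') xs \<and>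
        lst ''X'' \<tau> = rev (drop (nreg \<tau> ''l'') xs)"
      and V = "\<lambda>\<tau>. 40 * nreg \<tau> ''l'' + 5"], goal_cases)
    case 1
    then show ?case by (simp add: assms S)
  next
    case (2 \<tau>)
    define l where "l = nreg \<tau> ''l'' - 1"
    have l: "nreg \<tau> ''l'' = Suc l" using 2(3) by (simp add: l_def)
    have len: "l < length xs" and ST: "lst ''S'' \<tau> = ss @ take (Suc l) xs"
      and XT: "lst ''X'' \<tau> = rev (drop (Suc l) xs)" using 2(1) by (auto simp: l)
    have n: "nreg \<tau> ''S'' = length ss + Suc l" using length_lst[of \<tau> "''S''"] ST len by simp
    have r: "narr \<tau> ''S'' (length ss + l) = xs ! l"
      using len ST by (simp add: narr_lst nth_append)
    show ?case using len
      by (simp add: l n r ST XT Cons_nth_drop_Suc[symmetric] take_append min_def)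
  next
    case (3 \<tau>)
    then show ?case by simp
  next
    case (4 t \<tau>)
    then show ?case using frame_nreg[OF 4(2), of "''k''"] by simp
  qed
qed

context points
begin

abbreviation cntA :: "nat list \<Rightarrow> nat" where
  "cntA xs \<equiv> length (filter (\<lambda>x. x < nA) xs)"

abbreviation cntB :: "nat list \<Rightarrow> nat" where
  "cntB xs \<equiv> length (filter (\<lambda>x. \<not> x < nA) xs)"

lemma cntA_cntB: "cntA xs + cntB xs = length xs"
  by (rule sum_length_filter_compl)

lemma wp_Count:
  assumes "layout \<sigma>"
  shows "wp Count \<sigma> (\<lambda>t \<tau>. nreg \<tau> ''nn'' = cntA (lst ''X'' \<sigma>) \<and> nreg \<tau> ''mm'' = cntB (lst ''X'' \<sigma>) \<and>
    (0 < cntA (lst ''X'' \<sigma>) \<longrightarrow> nreg \<tau> ''u'' < nA \<and> nreg \<tau> ''u'' \<in> set (lst ''X'' \<sigma>)) \<and>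
    (0 < cntB (lst ''X'' \<sigma>) \<longrightarrow> nreg \<tau> ''v'' + nA \<in> set (lst ''X'' \<sigma>)) \<and>
    t \<le> 40 * length (lst ''X'' \<sigma>) + 20)"
proof -
  define L where "L = lst ''X'' \<sigma>"
  have X0: "nreg \<sigma> ''X'' = length L" using length_lst[of \<sigma> "''X''"] by (simp add: L_def)
  show ?thesis
    unfolding Count_def
    apply simp
  proof (rule wp_While_measure[where I = "\<lambda>\<tau>. nreg \<tau> ''b'' \<le> length L \<and>
        nreg \<tau> ''nn'' = cntA (take (nreg \<tau> ''b'') L) \<and> nreg \<tau> ''mm'' = cntB (take (nreg \<tau> ''b'') L) \<and>
        (0 < nreg \<tau> ''nn'' \<longrightarrow> nreg \<tau> ''u'' < nA \<and> nreg \<tau> ''u'' \<in> set L) \<and>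
        (0 < nreg \<tau> ''mm'' \<longrightarrow> nreg \<tau> ''v'' + nA \<in> set L)"
      and V = "\<lambda>\<tau>. 40 * (length L - nreg \<tau> ''b'') + 10"], goal_cases)
    case 1
    then show ?case by simp
  next
    case (2 \<tau>)
    have fr: "nreg \<tau> ''X'' = length L" "lst ''X'' \<tau> = L"
      using frame_simps[OF 2(2)] by (simp_all add: X0 L_def)
    have lay: "layout \<tau>" using layout_frame[OF 2(2)] assms(1) by simp
    then have A: "nreg \<tau> ''sizeA'' = nA" by (simp add: layout_def)
    have b: "nreg \<tau> ''b'' < length L" using 2(3) by (simp add: fr)
    have X: "narr \<tau> ''X'' (nreg \<tau> ''b'') = L ! nreg \<tau> ''b''" using b narr_lst[of _ "''X''" \<tau>] fr by simp
    show ?case using 2(1) b nth_mem[OF b]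
      by (auto simp: A X take_Suc_conv_app_nth)
  next
    case (3 \<tau>)
    then show ?case by simp
  next
    case (4 t \<tau>)
    then show ?case using frame_nreg[OF 4(2), of "''X''"] by (auto simp: X0 L_def[symmetric])
  qed
qed

lemma wp_Product:
  "wp Product \<sigma> (\<lambda>t \<tau>. nreg \<tau> ''h'' = nreg \<sigma> ''nn'' * nreg \<sigma> ''mm'' \<and> t \<le> 20 * nreg \<sigma> ''nn'' + 20)"
  unfolding Product_def
  apply simp
proof (rule wp_While_measure[where I = "\<lambda>\<tau>. nreg \<tau> ''h'' + nreg \<tau> ''c'' * nreg \<sigma> ''mm'' = nreg \<sigma> ''nn'' * nreg \<sigma> ''mm''"
      and V = "\<lambda>\<tau>. 20 * nreg \<tau> ''c'' + 10"], goal_cases)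
  case 1
  then show ?case by simp
next
  case (2 \<tau>)
  obtain c where "nreg \<tau> ''c'' = Suc c" using 2(3) by (cases "nreg \<tau> ''c''") auto
  then show ?case using 2(1) frame_nreg[OF 2(2), of "''mm''"] by simp
qed auto

lemma wp_Cross:
  fixes \<sigma>
  defines "L \<equiv> lst ''X'' \<sigma>"
  defines "wt \<equiv> \<lambda>xs. cntB L * cntA xs + cntA L * cntB xs"
  assumes "layout \<sigma>" "nreg \<sigma> ''nn'' = cntA L" "nreg \<sigma> ''mm'' = cntB L"
    and h: "nreg \<sigma> ''h'' = cntA L * cntB L" "0 < nreg \<sigma> ''h''"
  shows "wp Cross \<sigma> (\<lambda>t \<tau>. \<exists>p<length L. nreg \<tau> ''p'' = p \<and> nreg \<tau> ''x'' = L ! p \<and>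
    wt (take p L) < cntA L * cntB L \<and> cntA L * cntB L \<le> wt (take (Suc p) L) \<and> t \<le> 40 * length L + 30)"
proof -
  have X0: "nreg \<sigma> ''X'' = length L" using length_lst[of \<sigma> "''X''"] by (simp add: L_def)
  have arr: "narr \<sigma> ''X'' i = L ! i" if "i < length L" for i using that by (simp add: L_def narr_lst)
  show ?thesis
    unfolding Cross_def
    apply simp
  proof (rule wp_While_measure[where I = "\<lambda>\<tau>. nreg \<tau> ''p'' \<le> length L \<and>
        nreg \<tau> ''a'' = wt (take (nreg \<tau> ''p'') L) \<and>
        (nreg \<tau> ''p'' = 0 \<or> wt (take (nreg \<tau> ''p'' - 1) L) < nreg \<sigma> ''h'')"
      and V = "\<lambda>\<tau>. 30 * (length L - nreg \<tau> ''p'') + 10"], goal_cases)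
    case 1
    then show ?case by (simp add: wt_def)
  next
    case (2 \<tau>)
    have fr: "nreg \<tau> ''nn'' = cntA L" "nreg \<tau> ''mm'' = cntB L" "nreg \<tau> ''h'' = nreg \<sigma> ''h''"
      "narr \<tau> ''X'' = narr \<sigma> ''X''"
      using frame_simps[OF 2(2)] assms(4,5) by simp_all
    have lay: "layout \<tau>" using layout_frame[OF 2(2)] assms(3) by simp
    then have A: "nreg \<tau> ''sizeA'' = nA" by (simp add: layout_def)
    define p where "p = nreg \<tau> ''p''"
    have lt: "wt (take p L) < nreg \<sigma> ''h''" using 2(1,3) by (simp add: fr p_def)
    \<comment> \<open>The whole list weighs \<open>2 * h\<close>, so the threshold is reached no
      later than at its last point.\<close>
    then have "p \<noteq> length L" by (auto simp: h(1) wt_def)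
    then have p: "p < length L" using 2(1) by (simp add: p_def)
    have "wt (take (Suc p) L) = wt (take p L) + (if L ! p < nA then cntB L else cntA L)"
      using p by (simp add: take_Suc_conv_app_nth wt_def algebra_simps)
    then show ?case using 2(1) p lt
      by (simp add: A fr arr p_def[symmetric])
  next
    case (3 \<tau>)
    then show ?case by simp
  next
    case (4 t \<tau>)
    have fr: "nreg \<tau> ''h'' = nreg \<sigma> ''h''" "narr \<tau> ''X'' = narr \<sigma> ''X''"
      using frame_simps[OF 4(2)] by simp_all
    \<comment> \<open>As \<open>h\<close> is positive, the empty prefix does not reach it, and the
      decrement after the loop is not truncated.\<close>
    have "nreg \<tau> ''p'' \<noteq> 0" using 4(1,3) h(2) by (intro notI) (simp add: wt_def fr)
    then obtain p where p: "nreg \<tau> ''p'' = Suc p" by (cases "nreg \<tau> ''p''") auto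
    have "p < length L" using 4(1) p by simp
    then show ?case using 4 by (simp add: fr p arr h(1))
  qed
qed

end

section \<open>Testing the pivot and collecting the points of a subproblem\<close>

context points
begin

definition pair :: "nat \<Rightarrow> nat \<Rightarrow> bool" where
  "pair x y \<longleftrightarrow> x < nA \<and> nA \<le> y \<and> y < n \<and> (\<forall>k<d. cd y k \<le> cd x k)"

lemma wp_Compare:
  assumes "layout \<sigma>" "nreg \<sigma> ''u'' < n" "nreg \<sigma> ''v'' < n"
  shows "wp Compare \<sigma> (\<lambda>t \<tau>. (nreg \<tau> ''c'' < d \<longleftrightarrow> \<not> (\<forall>k<d. cd (nreg \<sigma> ''v'') k \<le> cd (nreg \<sigma> ''u'') k)) \<and>
    t \<le> 30 * d + 30)"
  unfolding Compare_def
  apply simp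
proof (rule wp_While_measure[where I = "\<lambda>\<tau>. nreg \<tau> ''c'' \<le> d \<and>
      (\<forall>k<nreg \<tau> ''c''. cd (nreg \<sigma> ''v'') k \<le> cd (nreg \<sigma> ''u'') k)"
    and V = "\<lambda>\<tau>. 30 * (d - nreg \<tau> ''c'') + 20"], goal_cases)
  case 1
  then show ?case by simp
next
  case (2 \<tau>)
  have lay: "layout \<tau>" using layout_frame[OF 2(2)] assms(1) by simp
  have fr: "nreg \<tau> ''u'' = nreg \<sigma> ''u''" "nreg \<tau> ''v'' = nreg \<sigma> ''v''" using frame_simps[OF 2(2)] by simp_all
  show ?case using 2(1,3) lay assms(2,3)
    by (auto simp: Co_def layout_def fr less_Suc_eq)
next
  case (3 \<tau>)
  then show ?case by (simp add: Co_def)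
next
  case (4 t \<tau>)
  have lay: "layout \<tau>" using layout_frame[OF 4(2)] assms(1) by simp
  have fr: "nreg \<tau> ''u'' = nreg \<sigma> ''u''" "nreg \<tau> ''v'' = nreg \<sigma> ''v''" using frame_simps[OF 4(2)] by simp_all
  define c where "c = nreg \<tau> ''c''"
  have "c < d \<Longrightarrow> cd (nreg \<sigma> ''u'') c < cd (nreg \<sigma> ''v'') c"
    using 4(3) lay assms(2,3) by (auto simp: Co_def layout_def fr c_def)
  moreover have "c \<le> d" "\<forall>k<c. cd (nreg \<sigma> ''v'') k \<le> cd (nreg \<sigma> ''u'') k" using 4(1) by (auto simp: c_def)
  ultimately have "c < d \<longleftrightarrow> \<not> (\<forall>k<d. cd (nreg \<sigma> ''v'') k \<le> cd (nreg \<sigma> ''u'') k)"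
    by (metis le_neq_implies_less not_less)
  then show ?case using 4(4) by (simp add: c_def)
qed

lemma wp_Brute:
  assumes "layout \<sigma>" "\<forall>y \<in> set (lst ''X'' \<sigma>). y < n" "nreg \<sigma> ''x'' < n" "nreg \<sigma> ''found'' = 0"
  shows "wp Brute \<sigma> (\<lambda>t \<tau>. (nreg \<tau> ''found'' = 0 \<and>
        (\<forall>y \<in> set (lst ''X'' \<sigma>). \<not> pair y (nreg \<sigma> ''x'') \<and> \<not> pair (nreg \<sigma> ''x'') y) \<or>
      nreg \<tau> ''found'' = 1 \<and> pair (nreg \<tau> ''i'') (nreg \<tau> ''j'' + nA)) \<and>
    t \<le> (30 * d + 100) * length (lst ''X'' \<sigma>) + 20)"
proof -
  define L x where "L = lst ''X'' \<sigma>" "x = nreg \<sigma> ''x''"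
  note defs = this
  have X0: "nreg \<sigma> ''X'' = length L" using length_lst[of \<sigma> "''X''"] by (simp add: defs)
  show ?thesis
    unfolding Brute_def wp_Seq wp_NAssign
  proof (rule wp_While_measure[where I = "\<lambda>\<tau>. nreg \<tau> ''b'' \<le> length L \<and>
        (nreg \<tau> ''found'' = 0 \<and> (\<forall>y \<in> set (take (nreg \<tau> ''b'') L). \<not> pair y x \<and> \<not> pair x y) \<or>
         nreg \<tau> ''found'' = 1 \<and> pair (nreg \<tau> ''i'') (nreg \<tau> ''j'' + nA))"
      and V = "\<lambda>\<tau>. (30 * d + 100) * (length L - nreg \<tau> ''b'') + 10"], goal_cases)
    case 1
    then show ?case using assms by simp
  next
    case (2 \<tau>)
    have fr: "nreg \<tau> ''X'' = length L" "lst ''X'' \<tau> = L" "nreg \<tau> ''x'' = x"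
      using frame_simps[OF 2(2)] by (simp_all add: X0 defs)
    have lay: "layout \<tau>" using layout_frame[OF 2(2)] assms(1) by simp
    then have A: "nreg \<tau> ''sizeA'' = nA" by (simp add: layout_def)
    define b where "b = nreg \<tau> ''b''"
    have b: "b < length L" using 2(3) by (simp add: fr b_def)
    have X: "narr \<tau> ''X'' b = L ! b" using b narr_lst[of _ "''X''" \<tau>] fr by simp
    define u v where "u = (if L ! b < nA then L ! b else x)" "v = (if L ! b < nA then x else L ! b)"
    note uv = this
    have "u < n" "v < n" using assms(2,3) b by (auto simp: uv defs)
    \<comment> \<open>The case distinction on \<open>L ! b\<close> already fixes the only
      orientation in which the two points can form a pair.\<close>
    have p: "pair (L ! b) x \<or> pair x (L ! b) \<longleftrightarrow> u < nA \<and> nA \<le> v \<and> (\<forall>k<d. cd v k \<le> cd u k)"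
      using assms(2,3) b by (auto simp: uv defs pair_def)
    let ?\<sigma> = "setN ''v'' v (setN ''u'' u \<tau>)"
    let ?rest = "Compare ;;
      Cond (Conj (Neg (NLess (NReg ''c'') (NReg ''dim'')))
            (Conj (NLess (NReg ''u'') (NReg ''sizeA'')) (Neg (NLess (NReg ''v'') (NReg ''sizeA'')))))
        (NAssign ''found'' (NConst 1) ;; NAssign ''i'' (NReg ''u'') ;;
          NAssign ''j'' (NSub (NReg ''v'') (NReg ''sizeA'')))
        Skip ;;
      incr ''b''"
    have rest: "wp ?rest ?\<sigma> (\<lambda>t \<rho>. nreg \<rho> ''b'' = Suc b \<and> t \<le> 30 * d + 60 \<and>
        (nreg \<rho> ''found'' = 0 \<and> (\<forall>y \<in> set (take (Suc b) L). \<not> pair y x \<and> \<not> pair x y) \<or>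
         nreg \<rho> ''found'' = 1 \<and> pair (nreg \<rho> ''i'') (nreg \<rho> ''j'' + nA)))"
      unfolding wp_Seq
    proof (rule wp_conseq[OF wp_Compare], goal_cases)
      case (4 t \<rho>)
      define dm where "dm \<longleftrightarrow> (\<forall>k<d. cd v k \<le> cd u k)"
      have c: "nreg \<rho> ''c'' < d \<longleftrightarrow> \<not> dm" and t: "t \<le> 30 * d + 30" using 4(1) by (auto simp: dm_def)
      have r: "nreg \<rho> ''dim'' = d" "nreg \<rho> ''sizeA'' = nA" "nreg \<rho> ''u'' = u" "nreg \<rho> ''v'' = v"
        "nreg \<rho> ''b'' = b" "nreg \<rho> ''found'' = nreg \<tau> ''found''" "nreg \<rho> ''i'' = nreg \<tau> ''i''"
        "nreg \<rho> ''j'' = nreg \<tau> ''j''"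
        using frame_simps[OF 4(2)] lay by (simp_all add: layout_def b_def)
      have inv: "nreg \<tau> ''found'' = 0 \<and> (\<forall>y \<in> set (take b L). \<not> pair y x \<and> \<not> pair x y) \<or>
         nreg \<tau> ''found'' = 1 \<and> pair (nreg \<tau> ''i'') (nreg \<tau> ''j'' + nA)"
        using 2(1) by (simp add: b_def)
      have tk: "set (take (Suc b) L) = insert (L ! b) (set (take b L))"
        using b by (simp add: take_Suc_conv_app_nth)
      show ?case
      proof (cases "dm \<and> u < nA \<and> nA \<le> v")
        case True
        then have "pair u v" using \<open>v < n\<close> by (simp add: pair_def dm_def)
        then show ?thesis using True t by (simp add: r c)
      next
        case False
        then have "\<not> pair (L ! b) x \<and> \<not> pair x (L ! b)" using p by (auto simp: dm_def)
        then show ?thesis using False t inv by (auto simp: r c tk)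
      qed
    qed (use \<open>u < n\<close> \<open>v < n\<close> lay in auto)
    have d: "length L - b = Suc (length L - Suc b)" using b by simp
    have branch: "wp (Cond (NLess (NArr ''X'' (NReg ''b'')) (NReg ''sizeA''))
        (NAssign ''u'' (NArr ''X'' (NReg ''b'')) ;; NAssign ''v'' (NReg ''x''))
        (NAssign ''u'' (NReg ''x'') ;; NAssign ''v'' (NArr ''X'' (NReg ''b'')))) \<tau> P"
      if "\<And>t. t \<le> 15 \<Longrightarrow> P t ?\<sigma>" for P
      using that[of 9] by (cases "L ! b < nA") (simp_all add: A X fr uv b_def[symmetric] eval_nat_numeral)
    show ?case
    proof (subst wp_Seq, rule branch, rule wp_mono[OF rest], goal_cases)
      case (1 t t' \<rho>)
      then show ?case using b by (auto simp: d b_def[symmetric])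
    qed
  next
    case (3 \<tau>)
    then show ?case by simp
  next
    case (4 t \<tau>)
    then show ?case using frame_nreg[OF 4(2), of "''X''"] by (auto simp: X0 defs)
  qed
qed

text \<open>The tests in \<open>Part\<close> look at positions relative to the pivot, hence a filter
  over indices instead of values.\<close>

definition select :: "(nat \<Rightarrow> bool) \<Rightarrow> (nat \<Rightarrow> bool) \<Rightarrow> nat list \<Rightarrow> nat list" where
  "select PA PB xs = map ((!) xs) (filter (\<lambda>i. if xs ! i < nA then PA i else PB i) [0..<length xs])"

lemma wp_Part:
  assumes "layout \<sigma>"
    and "\<And>\<tau>. nreg \<tau> ''p'' = nreg \<sigma> ''p'' \<Longrightarrow> bval bA \<tau> \<longleftrightarrow> PA (nreg \<tau> ''b'')"
    and "\<And>\<tau>. nreg \<tau> ''p'' = nreg \<sigma> ''p'' \<Longrightarrow> bval bB \<tau> \<longleftrightarrow> PB (nreg \<tau> ''b'')"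
    and cost: "bcost bA \<le> 3" "bcost bB \<le> 3" "ncost e \<le> 3"
    and e: "\<And>\<tau>. nreg \<tau> ''k'' = nreg \<sigma> ''k'' \<Longrightarrow> nval e \<tau> = m"
  shows "wp (Part bA bB e) \<sigma> (\<lambda>t \<tau>. 
    lst ''S'' \<tau> = lst ''S'' \<sigma> @ select PA PB (lst ''X'' \<sigma>) @ [length (select PA PB (lst ''X'' \<sigma>)), m] \<and>
    t \<le> 50 * length (lst ''X'' \<sigma>) + 50)"
proof -
  define L where "L = lst ''X'' \<sigma>"
  have X0: "nreg \<sigma> ''X'' = length L" using length_lst[of \<sigma> "''X''"] by (simp add: L_def)
  let ?sel = "\<lambda>b. map ((!) L) (filter (\<lambda>i. if L ! i < nA then PA i else PB i) [0..<b])"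
  show ?thesis
    unfolding Part_def
    apply simp
  proof (rule wp_While_measure[where I = "\<lambda>\<tau>. nreg \<tau> ''b'' \<le> length L \<and>
        lst ''S'' \<tau> = lst ''S'' \<sigma> @ ?sel (nreg \<tau> ''b'') \<and> nreg \<tau> ''c'' = length (?sel (nreg \<tau> ''b''))"
      and V = "\<lambda>\<tau>. 40 * (length L - nreg \<tau> ''b'') + 10"], goal_cases)
    case 1
    then show ?case by simp
  next
    case (2 \<tau>)
    have fr: "nreg \<tau> ''X'' = length L" "lst ''X'' \<tau> = L" "nreg \<tau> ''p'' = nreg \<sigma> ''p''"
      using frame_simps[OF 2(2)] by (simp_all add: X0 L_def)
    have lay: "layout \<tau>" using layout_frame[OF 2(2)] assms(1) by simp
    then have A: "nreg \<tau> ''sizeA'' = nA" by (simp add: layout_def)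
    define b where "b = nreg \<tau> ''b''"
    have b: "b < length L" using 2(3) by (simp add: fr b_def)
    have X: "narr \<tau> ''X'' b = L ! b" using b narr_lst[of _ "''X''" \<tau>] fr by simp
    show ?case using 2(1) b cost assms(2,3)[OF fr(3)]
      by (auto simp: A X b_def[symmetric])
  next
    case (3 \<tau>)
    then show ?case by simp
  next
    case (4 t \<tau>)
    then have "nreg \<tau> ''b'' = length L" using frame_nreg[OF 4(2), of "''X''"] by (simp add: X0)
    then show ?case using 4(1,4) cost e[of "push ''S'' (nreg \<tau> ''c'') \<tau>"] frame_nreg[OF 4(2), of "''k''"]
      by (auto simp: select_def L_def[symmetric])
  qed
qed

end
definition Split :: com where
  "Split = (Sort ;; Product ;; Cross ;; Brute ;;
    Part (NLess (NReg ''b'') (NReg ''p'')) (NLess (NReg ''b'') (NReg ''p'')) (NReg ''k'') ;;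
    Part (NLess (NReg ''p'') (NReg ''b'')) (NLess (NReg ''p'') (NReg ''b'')) (NReg ''k'') ;;
    Part (NLess (NReg ''p'') (NReg ''b'')) (NLess (NReg ''b'') (NReg ''p'')) (NAdd (NReg ''k'') (NConst 1)))"

lemma wr_Split [simp]: "wr Split = {''X'', ''W'', ''f'', ''p'', ''e'', ''q'', ''g'', ''w'', ''h'', ''c'',
    ''a'', ''x'', ''b'', ''u'', ''v'', ''found'', ''i'', ''j'', ''S''}"
  by (auto simp: Split_def)

lemma map_nth_filter_drop:
  "map ((!) xs) (filter (\<lambda>i. P (xs ! i)) [p..<length xs]) = filter P (drop p xs)"
proof -
  have "drop p xs = map ((!) xs) [p..<length xs]"
    by (metis drop_map drop_upt add_0 map_nth)
  then show ?thesis by (simp add: filter_map comp_def)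
qed

lemma map_nth_filter_take:
  "p \<le> length xs \<Longrightarrow> map ((!) xs) (filter (\<lambda>i. P (xs ! i)) [0..<p]) = filter P (take p xs)"
proof -
  assume "p \<le> length xs"
  then have "take p xs = map ((!) xs) [0..<p]" by (metis add_0 map_nth take_map take_upt)
  then show ?thesis by (simp add: filter_map comp_def)
qed

context points
begin

definition cross :: "nat \<Rightarrow> nat list \<Rightarrow> nat list" where
  "cross p xs = filter (\<lambda>x. \<not> x < nA) (take p xs) @ filter (\<lambda>x. x < nA) (drop (Suc p) xs)"

lemma select_eq:
  assumes "p < length xs"
  shows "select (\<lambda>i. i < p) (\<lambda>i. i < p) xs = take p xs"
    and "select (\<lambda>i. p < i) (\<lambda>i. p < i) xs = drop (Suc p) xs"
    and "select (\<lambda>i. p < i) (\<lambda>i. i < p) xs = cross p xs"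
proof -
  have u: "[0..<length xs] = [0..<p] @ p # [Suc p..<length xs]"
    using assms upt_add_eq_append[of 0 p "length xs - p"] by (simp add: upt_conv_Cons)
  have lo: "filter (\<lambda>i. if xs ! i < nA then PA i else PB i) [0..<p] = filter (\<lambda>i. Q (xs ! i)) [0..<p]"
    if "\<And>i. i < p \<Longrightarrow> (if xs ! i < nA then PA i else PB i) = Q (xs ! i)" for PA PB Q
    using that by (intro filter_cong) auto
  have hi: "filter (\<lambda>i. if xs ! i < nA then PA i else PB i) [Suc p..<length xs] =
      filter (\<lambda>i. Q (xs ! i)) [Suc p..<length xs]"
    if "\<And>i. p < i \<Longrightarrow> (if xs ! i < nA then PA i else PB i) = Q (xs ! i)" for PA PB Q
    using that by (intro filter_cong) auto
  note nths = map_nth_filter_take[OF less_imp_le[OF assms]] map_nth_filter_drop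
  show "select (\<lambda>i. i < p) (\<lambda>i. i < p) xs = take p xs"
    unfolding select_def u filter_append
    by (simp add: lo[where Q = "\<lambda>_. True"] hi[where Q = "\<lambda>_. False"] nths(1)[of "\<lambda>_. True", simplified])
  show "select (\<lambda>i. p < i) (\<lambda>i. p < i) xs = drop (Suc p) xs"
    unfolding select_def u filter_append
    by (simp add: lo[where Q = "\<lambda>_. False"] hi[where Q = "\<lambda>_. True"] nths(2)[of _ "\<lambda>_. True", simplified])
  show "select (\<lambda>i. p < i) (\<lambda>i. i < p) xs = cross p xs"
    unfolding select_def u filter_append
    by (simp add: lo[where Q = "\<lambda>x. \<not> x < nA"] hi[where Q = "\<lambda>x. x < nA"] cross_def
        nths(1)[of "\<lambda>x. \<not> x < nA"] nths(2)[of _ "\<lambda>x. x < nA"])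
qed

lemma wp_Split:
  fixes \<sigma>
  defines "X \<equiv> lst ''X'' \<sigma>" and "k \<equiv> nreg \<sigma> ''k''"
  assumes "layout \<sigma>" "k < d" "\<forall>x \<in> set X. x < n" "length X \<le> 2 ^ r" "nreg \<sigma> ''found'' = 0"
    and "nreg \<sigma> ''nn'' = cntA X" "nreg \<sigma> ''mm'' = cntB X" "0 < cntA X" "0 < cntB X"
  shows "wp Split \<sigma> (\<lambda>t \<tau>. \<exists>L p. mset L = mset X \<and> sorted_wrt (le k) L \<and> p < length L \<and>
      cntB L * cntA (take p L) + cntA L * cntB (take p L) < cntA L * cntB L \<and>
      cntA L * cntB L \<le> cntB L * cntA (take (Suc p) L) + cntA L * cntB (take (Suc p) L) \<and>
      lst ''S'' \<tau> = lst ''S'' \<sigma> @ take p L @ [p, k] @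
        drop (Suc p) L @ [length L - Suc p, k] @ cross p L @ [length (cross p L), Suc k] \<and>
      (nreg \<tau> ''found'' = 0 \<and> (\<forall>y \<in> set L. \<not> pair y (L ! p) \<and> \<not> pair (L ! p) y) \<or>
       nreg \<tau> ''found'' = 1 \<and> pair (nreg \<tau> ''i'') (nreg \<tau> ''j'' + nA)) \<and>
      t \<le> 1000 * ((length X + 1) * (r + d + 1)))"
  unfolding Split_def wp_Seq
proof (rule wp_conseq[OF wp_Sort[of \<sigma> r]], goal_cases)
  case (5 t1 \<sigma>1)
  define L where "L = lst ''X'' \<sigma>1"
  have L: "mset L = mset X" "sorted_wrt (le k) L" and t1: "t1 \<le> (220 * length X + 60) * (r + 1)"
    using 5(1) by (auto simp: L_def assms(1,2))
  have cnt: "cntA L = cntA X" "cntB L = cntB X" "length L = length X" "set L = set X"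
    using L(1) by (metis mset_filter size_mset, metis mset_filter size_mset, metis size_mset, metis set_mset_mset)
  note f1 = frame_simps[OF 5(2), unfolded wr_Sort]
  have lay1: "layout \<sigma>1" using layout_frame[OF 5(2)] assms(3) by simp
  show ?case
  proof (rule wp_conseq[OF wp_Product], goal_cases)
    case (1 t2 \<sigma>2)
    note f2 = frame_simps[OF 1(2), unfolded wr_Product]
    have lay2: "layout \<sigma>2" using layout_frame[OF 1(2)] lay1 by simp
    have h: "nreg \<sigma>2 ''h'' = cntA L * cntB L" and t2: "t2 \<le> 20 * length X + 20"
      using 1(1) assms(8,9) cntA_cntB[of X] by (auto simp: f1 cnt)
    have X2: "lst ''X'' \<sigma>2 = L" by (simp add: f2 L_def)
    show ?case
    proof (rule wp_conseq[OF wp_Cross], goal_cases)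
      case (6 t3 \<sigma>3)
      note f3 = frame_simps[OF 6(2), unfolded wr_Cross]
      have lay3: "layout \<sigma>3" using layout_frame[OF 6(2)] lay2 by simp
      obtain p where p: "p < length L" "nreg \<sigma>3 ''p'' = p" "nreg \<sigma>3 ''x'' = L ! p"
        "cntB L * cntA (take p L) + cntA L * cntB (take p L) < cntA L * cntB L"
        "cntA L * cntB L \<le> cntB L * cntA (take (Suc p) L) + cntA L * cntB (take (Suc p) L)"
        and t3: "t3 \<le> 40 * length X + 30"
        using 6(1) unfolding X2 cnt(3) by blast
      have pn: "L ! p < n" using p(1) cnt(4) assms(5) nth_mem by blast
      have X3: "lst ''X'' \<sigma>3 = L" by (simp add: f3 X2)
      show ?case
      proof (rule wp_conseq[OF wp_Brute], goal_cases)
        case (5 t4 \<sigma>4)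
        note f4 = frame_simps[OF 5(2), unfolded wr_Brute]
        have lay4: "layout \<sigma>4" using layout_frame[OF 5(2)] lay3 by simp
        have X4: "lst ''X'' \<sigma>4 = L" by (simp add: f4 X3)
        have p4: "nreg \<sigma>4 ''p'' = p" by (simp add: f4 p)
        have k4: "nreg \<sigma>4 ''k'' = k" by (simp add: f4 f3 f2 f1 k_def)
        have found: "nreg \<sigma>4 ''found'' = 0 \<and> (\<forall>y \<in> set L. \<not> pair y (L ! p) \<and> \<not> pair (L ! p) y) \<or>
            nreg \<sigma>4 ''found'' = 1 \<and> pair (nreg \<sigma>4 ''i'') (nreg \<sigma>4 ''j'' + nA)"
          and t4: "t4 \<le> (30 * d + 100) * length X + 20"
          using 5(1) by (simp_all add: X3 p cnt)
        show ?case
        proof (rule wp_conseq[OF wp_Part[where PA = "\<lambda>i. i < p" and PB = "\<lambda>i. i < p" and m = k]], goal_cases)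
          case (8 t5 \<sigma>5)
          note p5 = 8(1)
          note f5 = frame_simps[OF 8(2), unfolded wr_Part]
          have lay5: "layout \<sigma>5" using layout_frame[OF 8(2)] lay4 by simp
          show ?case
          proof (rule wp_conseq[OF wp_Part[where PA = "\<lambda>i. p < i" and PB = "\<lambda>i. p < i" and m = k]], goal_cases)
            case (8 t6 \<sigma>6)
            note p6 = 8(1)
            note f6 = frame_simps[OF 8(2), unfolded wr_Part]
            have lay6: "layout \<sigma>6" using layout_frame[OF 8(2)] lay5 by simp
            show ?case
            proof (rule wp_conseq[OF wp_Part[where PA = "\<lambda>i. p < i" and PB = "\<lambda>i. i < p" and m = "Suc k"]], goal_cases)
              case (8 t7 \<sigma>7)
              note f7 = frame_simps[OF 8(2), unfolded wr_Part]
              have S: "lst ''S'' \<sigma>7 = lst ''S'' \<sigma> @ take p L @ [p, k] @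
                  drop (Suc p) L @ [length L - Suc p, k] @ cross p L @ [length (cross p L), Suc k]"
                using 8(1) p5 p6 p(1)
                by (simp add: X4 f6 f5 f4 f3 f2 f1 select_eq min_def)
              have t567: "t5 \<le> 50 * length X + 50" "t6 \<le> 50 * length X + 50" "t7 \<le> 50 * length X + 50"
                using 8(1) p5 p6 by (simp_all add: X4 f6 f5 cnt)
              have found': "nreg \<sigma>7 ''found'' = 0 \<and> (\<forall>y \<in> set L. \<not> pair y (L ! p) \<and> \<not> pair (L ! p) y) \<or>
                  nreg \<sigma>7 ''found'' = 1 \<and> pair (nreg \<sigma>7 ''i'') (nreg \<sigma>7 ''j'' + nA)"
                using found by (simp add: f7 f6 f5)
              \<comment> \<open>All phases are charged to the single product \<open>P\<close>, where
                \<open>r\<close> stems from sorting and \<open>d\<close> from the comparisons with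
                the pivot. The factors add up to 550, so 1000 is generous.\<close>
              define l P where "l = length X" "P = (l + 1) * (r + d + 1)"
              note lP = this
              have "(220 * l + 60) * (r + 1) \<le> (220 * (l + 1)) * (r + d + 1)" by (intro mult_mono) auto
              moreover have "(30 * d + 100) * l \<le> (100 * (r + d + 1)) * (l + 1)" by (intro mult_mono) auto
              moreover have "(l + 1) * 1 \<le> (l + 1) * (r + d + 1)" by (intro mult_mono) auto
              ultimately have "(220 * l + 60) * (r + 1) \<le> 220 * P" "(30 * d + 100) * l \<le> 100 * P" "l + 1 \<le> P"
                by (simp_all only: lP ac_simps mult_1_left)
              then have "t1 + (t2 + (t3 + (t4 + (t5 + (t6 + t7))))) \<le> 1000 * P"
                using t1 t2 t3 t4 t567 unfolding lP(1)[symmetric] by linarith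
              then show ?case using L p S found' unfolding lP by blast
            qed (use lay6 p4 k4 in \<open>auto simp: f5 f6\<close>)
          qed (use lay5 p4 k4 in \<open>auto simp: f5\<close>)
        qed (use lay4 p4 k4 in auto)
      qed (use lay3 pn p(3) assms(5,7) in \<open>auto simp: X3 cnt f3 f2 f1\<close>)
    qed (use lay2 assms(8-11) in \<open>auto simp: X2 cnt f2 f1 h\<close>)
  qed
qed (use assms(3-6) in \<open>auto simp: assms(1,2)\<close>)

end
section \<open>The main loop\<close>

text \<open>A subproblem with an empty side contains no pair and is dropped; this also ensures the
  positive threshold that \<open>Cross\<close> needs.\<close>

definition Item :: com where
  "Item = (Pop ;; Count ;;
    Cond (Conj (NLess (NConst 0) (NReg ''nn'')) (NLess (NConst 0) (NReg ''mm'')))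
      (Cond (NLess (NReg ''k'') (NReg ''dim''))
        Split
        (NAssign ''found'' (NConst 1) ;; NAssign ''i'' (NReg ''u'') ;; NAssign ''j'' (NReg ''v'')))
      Skip)"

definition Main :: com where
  "Main = While (Conj (NLess (NConst 0) (NReg ''S'')) (NLess (NReg ''found'') (NConst 1))) Item"

lemma wr_Item [simp]: "wr Item = {''X'', ''W'', ''f'', ''p'', ''e'', ''q'', ''g'', ''w'', ''h'', ''c'',
    ''a'', ''x'', ''b'', ''u'', ''v'', ''found'', ''i'', ''j'', ''S'', ''k'', ''l'', ''nn'', ''mm''}"
  by (auto simp: Item_def)

text \<open>
  A pending subproblem \<open>(xs, k)\<close>, in which domination is known for the coordinates below \<open>k\<close>. The
  length is stored behind the points so that the topmost subproblem can be popped.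
\<close>

definition encode :: "(nat list \<times> nat) list \<Rightarrow> nat list" where
  "encode its = concat (map (\<lambda>(xs, k). xs @ [length xs, k]) its)"

lemma encode_append: "encode (its @ its') = encode its @ encode its'"
  by (simp add: encode_def)

lemma encode_eq_Nil: "encode its = [] \<longleftrightarrow> its = []"
  by (cases its) (auto simp: encode_def)

section \<open>Invariants of the pending subproblems and termination of the main loop\<close>

context points
begin

text \<open>Instead of distinctness only the bounds on the two counts are maintained; they yield the
  length bound for sorting and the hypotheses on sizes in the recurrence.\<close>

definition valid :: "nat list \<Rightarrow> nat \<Rightarrow> bool" where
  "valid xs k \<longleftrightarrow> k \<le> d \<and> (\<forall>x\<in>set xs. x < n) \<and> cntA xs \<le> nA \<and> cntB xs \<le> n - nA \<and>
    (\<forall>x\<in>set xs. \<forall>y\<in>set xs. x < nA \<longrightarrow> nA \<le> y \<longrightarrow> (\<forall>i<k. cd y i \<le> cd x i))"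

lemma cnt_mset: "mset xs = mset ys \<Longrightarrow> cntA xs = cntA ys" "mset xs = mset ys \<Longrightarrow> cntB xs = cntB ys"
  by (metis mset_filter size_mset)+

lemma valid_mset: "mset xs = mset ys \<Longrightarrow> valid xs k \<longleftrightarrow> valid ys k"
  unfolding valid_def by (simp add: cnt_mset[of xs ys] mset_eq_setD[of xs ys])

lemma valid_subset:
  assumes "valid xs k" "set ys \<subseteq> set xs" "cntA ys \<le> cntA xs" "cntB ys \<le> cntB xs"
  shows "valid ys k"
proof -
  have "\<forall>x\<in>set ys. x < n"
    "\<forall>x\<in>set ys. \<forall>y\<in>set ys. x < nA \<longrightarrow> nA \<le> y \<longrightarrow> (\<forall>i<k. cd y i \<le> cd x i)"
    using assms(1,2) unfolding valid_def by blast+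
  then show ?thesis using assms unfolding valid_def by linarith
qed

lemma cnt_split: "p < length xs \<Longrightarrow>
    cntA xs = cntA (take (Suc p) xs) + cntA (drop (Suc p) xs) \<and>
    cntB xs = cntB (take (Suc p) xs) + cntB (drop (Suc p) xs)"
  by (metis append_take_drop_id filter_append length_append)

lemma cnt_cross: "cntA (cross p xs) = cntA (drop (Suc p) xs)" "cntB (cross p xs) = cntB (take p xs)"
  by (simp_all add: cross_def)

text \<open>Sortedness supplies coordinate \<open>k\<close> for the cross list: its points of B
  precede the pivot and its points of A follow it. The other two lists inherit everything from
  \<open>L\<close>.\<close>

lemma valid_children:
  assumes "valid L k" "sorted_wrt (le k) L" "p < length L" "k < d"
  shows "valid (take p L) k" "valid (drop (Suc p) L) k" "valid (cross p L) (Suc k)"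
proof -
  have s: "set (take p L) \<subseteq> set L" "set (drop (Suc p) L) \<subseteq> set L"
    by (auto dest: in_set_takeD in_set_dropD)
  have c: "cntA L = cntA (take (Suc p) L) + cntA (drop (Suc p) L)"
    "cntB L = cntB (take (Suc p) L) + cntB (drop (Suc p) L)"
    using cnt_split[OF assms(3)] by auto
  have c': "cntA (take p L) \<le> cntA (take (Suc p) L)" "cntB (take p L) \<le> cntB (take (Suc p) L)"
    using assms(3) by (auto simp: take_Suc_conv_app_nth)
  show "valid (take p L) k" "valid (drop (Suc p) L) k"
    using s c c' by (auto intro!: valid_subset[OF assms(1)])
  have "cd y k \<le> cd x k" if "x \<in> set (drop (Suc p) L)" "y \<in> set (take p L)" for x y
  proof -
    have "sorted_wrt (le k) (take p L @ L ! p # drop (Suc p) L)"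
      using assms(2,3) by (simp add: id_take_nth_drop[symmetric])
    then have "le k y x" using that by (simp add: sorted_wrt_append)
    then show ?thesis by (auto simp: le_def)
  qed
  then have "\<forall>x\<in>set (cross p L). \<forall>y\<in>set (cross p L). x < nA \<longrightarrow> nA \<le> y \<longrightarrow> cd y k \<le> cd x k"
    by (auto simp: cross_def)
  moreover have "valid (cross p L) k"
    using s c c' by (intro valid_subset[OF assms(1)]) (auto simp: cnt_cross, auto simp: cross_def)
  ultimately show "valid (cross p L) (Suc k)"
    using assms(4) unfolding valid_def by (simp add: less_Suc_eq_le Suc_le_eq all_conj_distrib) (metis less_antisym not_less_eq_eq le_neq_implies_less)
qed

text \<open>The one case not covered is a point of A before the pivot and a point of B after it.
  Such points form no pair: the tie rule of \<open>le\<close> rules out equal coordinates, so the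
  point of A is strictly smaller in coordinate \<open>k\<close>.\<close>

lemma pair_children:
  assumes "sorted_wrt (le k) L" "p < length L" "k < d" "pair x y" "x \<in> set L" "y \<in> set L"
    "x \<noteq> L ! p" "y \<noteq> L ! p"
  shows "{x, y} \<subseteq> set (take p L) \<or> {x, y} \<subseteq> set (drop (Suc p) L) \<or> {x, y} \<subseteq> set (cross p L)"
proof -
  have L: "L = take p L @ L ! p # drop (Suc p) L"
    using assms(2) by (rule id_take_nth_drop)
  have "set L = set (take p L) \<union> {L ! p} \<union> set (drop (Suc p) L)" by (subst L) auto
  then have xy: "x \<in> set (take p L) \<or> x \<in> set (drop (Suc p) L)" "y \<in> set (take p L) \<or> y \<in> set (drop (Suc p) L)"
    using assms by auto
  have "\<not> (x \<in> set (take p L) \<and> y \<in> set (drop (Suc p) L))"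
  proof
    assume *: "x \<in> set (take p L) \<and> y \<in> set (drop (Suc p) L)"
    have "sorted_wrt (le k) (take p L @ L ! p # drop (Suc p) L)" using assms(1) L by simp
    then have "le k x y" using * by (simp add: sorted_wrt_append)
    then show False using assms(3,4) by (auto simp: le_def pair_def not_le[symmetric])
  qed
  then show ?thesis using xy assms(4) by (auto simp: cross_def pair_def)
qed

text \<open>
  Here \<open>a, b\<close> count the points of \<open>A\<close> and \<open>B\<close> before the pivot and \<open>a', b'\<close> those after it. The
  pivot is missing from these counts, but from only one of the two sets, whence the disjunction.
\<close>

definition splits :: "nat \<Rightarrow> nat \<Rightarrow> nat \<Rightarrow> nat \<Rightarrow> nat \<Rightarrow> nat \<Rightarrow> bool" where
  "splits nn mm a b a' b' \<longleftrightarrow> (a + a' = nn \<or> b + b' = mm) \<and>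
    mm * a + nn * b \<le> nn * mm \<and> mm * a' + nn * b' \<le> nn * mm"

text \<open>The prefix through the pivot carries at least half of the total weight
  \<open>2 * cntA L * cntB L\<close>, so the points after the pivot carry at most half.\<close>

lemma splits_cnt:
  assumes "p < length L"
    "cntB L * cntA (take p L) + cntA L * cntB (take p L) < cntA L * cntB L"
    "cntA L * cntB L \<le> cntB L * cntA (take (Suc p) L) + cntA L * cntB (take (Suc p) L)"
  shows "splits (cntA L) (cntB L) (cntA (take p L)) (cntB (take p L))
    (cntA (drop (Suc p) L)) (cntB (drop (Suc p) L))"
proof -
  define A1 B1 A2 B2 where "A1 = cntA (take (Suc p) L)" "B1 = cntB (take (Suc p) L)"
    "A2 = cntA (drop (Suc p) L)" "B2 = cntB (drop (Suc p) L)"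
  note defs = this
  have c: "cntA L = A1 + A2" "cntB L = B1 + B2" using cnt_split[OF assms(1)] by (auto simp: defs)
  have "cntA (take p L) = A1 \<or> cntB (take p L) = B1"
    using assms(1) by (auto simp: defs take_Suc_conv_app_nth)
  then have 1: "cntA (take p L) + A2 = cntA L \<or> cntB (take p L) + B2 = cntB L" unfolding c by auto
  have "(A1 + A2) * (B1 + B2) \<le> (B1 + B2) * A1 + (A1 + A2) * B1"
    using assms(3) unfolding c defs(1,2)[symmetric] .
  then have "(B1 + B2) * A2 + (A1 + A2) * B2 \<le> (A1 + A2) * (B1 + B2)"
    by (simp add: algebra_simps)
  then show ?thesis
    using 1 assms(2) unfolding splits_def defs(3,4)[symmetric] by (simp add: c)
qed

text \<open>The potential is left abstract to separate the program from the recurrence. Of the 3000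
  units released per step, 1000 pay for \<open>Split\<close> and at most 1000 for the overhead terms
  of the three new subproblems in \<open>pot\<close>.\<close>

lemma wp_Main:
  fixes \<Psi> :: "nat \<Rightarrow> nat \<Rightarrow> nat \<Rightarrow> real"
  assumes nonneg: "\<And>a b k. 0 \<le> \<Psi> a b k"
    and decr: "\<And>k nn mm a b a' b'. k < d \<Longrightarrow> 0 < nn \<Longrightarrow> 0 < mm \<Longrightarrow> nn \<le> nA \<Longrightarrow> mm \<le> n - nA \<Longrightarrow>
      splits nn mm a b a' b' \<Longrightarrow>
      \<Psi> a b k + \<Psi> a' b' k + \<Psi> a' b (Suc k) + 3000 * real ((nn + mm + 1) * (r + d + 1)) \<le> \<Psi> nn mm k"
    and n: "nA \<le> n" "n \<le> 2 ^ r"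
    and \<sigma>: "layout \<sigma>" "lst ''S'' \<sigma> = [0..<n] @ [n, 0]" "nreg \<sigma> ''found'' = 0"
  shows "wp Main \<sigma> (\<lambda>t \<tau>. (nreg \<tau> ''found'' = 0 \<and> (\<forall>x y. \<not> pair x y) \<or>
      nreg \<tau> ''found'' = 1 \<and> pair (nreg \<tau> ''i'') (nreg \<tau> ''j'' + nA)) \<and>
    real t \<le> \<Psi> nA (n - nA) 0 + 300 * (real n + 1) + 10)"
proof -
  \<comment> \<open>The second summand pays for popping and counting, which happens even for a
    subproblem with an empty side, where \<Psi> may vanish.\<close>
  define pot where "pot its = (\<Sum>(xs, k)\<leftarrow>its. \<Psi> (cntA xs) (cntB xs) k + 300 * (real (length xs) + 1))" for its
  have pot_nonneg: "0 \<le> pot its" for its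
    unfolding pot_def by (rule sum_list_nonneg) (auto intro: add_nonneg_nonneg nonneg)
  have cntU: "cntA [0..<n] = nA" "cntB [0..<n] = n - nA"
  proof -
    have "[0..<n] = [0..<nA] @ [nA..<n]" using upt_add_eq_append[of 0 nA "n - nA"] n by simp
    moreover have "filter (\<lambda>x. x < nA) [0..<nA] = [0..<nA]" "filter (\<lambda>x. x < nA) [nA..<n] = []"
      "filter (\<lambda>x. \<not> x < nA) [0..<nA] = []" "filter (\<lambda>x. \<not> x < nA) [nA..<n] = [nA..<n]"
      by (auto simp: filter_empty_conv intro: filter_True)
    ultimately show "cntA [0..<n] = nA" "cntB [0..<n] = n - nA" by simp_all
  qed
  \<comment> \<open>As long as nothing is found, every pair must survive in some pending subproblem;
    after a success the loop stops and the stack no longer matters.\<close>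
  let ?out = "\<lambda>its \<tau>. (nreg \<tau> ''found'' = 0 \<and> (\<forall>x y. pair x y \<longrightarrow> (\<exists>(xs, k)\<in>set its. {x, y} \<subseteq> set xs)) \<or>
      nreg \<tau> ''found'' = 1 \<and> pair (nreg \<tau> ''i'') (nreg \<tau> ''j'' + nA))"
  let ?I = "\<lambda>v \<tau>. \<exists>its. lst ''S'' \<tau> = encode its \<and> (\<forall>(xs, k)\<in>set its. valid xs k) \<and>
    v = pot its + 10 \<and> ?out its \<tau>"
  show ?thesis
    unfolding Main_def
  proof (rule wp_While_real[where I = ?I and v = "\<Psi> nA (n - nA) 0 + 300 * (real n + 1) + 10"], goal_cases)
    case 1
    show ?case
      using \<sigma>(2,3) n by (intro exI[of _ "[([0..<n], 0)]"])
        (auto simp: encode_def pot_def valid_def pair_def cntU)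
  next
    case (2 v \<tau>)
    obtain its0 where its0: "lst ''S'' \<tau> = encode its0" "\<forall>(xs, k)\<in>set its0. valid xs k" "v = pot its0 + 10"
      "?out its0 \<tau>" using 2(1) by blast
    have found: "nreg \<tau> ''found'' = 0" using 2(3) by simp
    have "nreg \<tau> ''S'' \<noteq> 0" using 2(3) by simp
    then have "its0 \<noteq> []" using its0(1) encode_eq_Nil[of its0] length_lst[of \<tau> "''S''"] by auto
    then obtain its xs k where its: "its0 = its @ [(xs, k)]"
      by (metis prod.exhaust rev_exhaust)
    have V: "valid xs k" "\<forall>(xs, k)\<in>set its. valid xs k" using its0(2) by (auto simp: its)
    have cover: "pair x y \<Longrightarrow> (\<exists>(ys, k)\<in>set its. {x, y} \<subseteq> set ys) \<or> {x, y} \<subseteq> set xs" for x y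
      using its0(4) found by (fastforce simp: its)
    have v: "v = pot its + \<Psi> (cntA xs) (cntB xs) k + 300 * (real (length xs) + 1) + 10"
      by (simp add: its0(3) its pot_def)
    have lay: "layout \<tau>" using layout_frame[OF 2(2)] \<sigma>(1) by simp
    have S: "lst ''S'' \<tau> = encode its @ xs @ [length xs, k]"
      using its0(1) by (simp add: its encode_def)
    have cnt: "cntA (rev xs) = cntA xs" "cntB (rev xs) = cntB xs" by (simp_all add: rev_filter[symmetric])
    have len: "length xs \<le> 2 ^ r"
    proof -
      have "cntA xs + cntB xs \<le> n" using V(1) n unfolding valid_def by linarith
      then show ?thesis using cntA_cntB[of xs] n by simp
    qed
    show ?case
      unfolding Item_def wp_Seq
    proof (rule wp_conseq[OF wp_Pop[OF S]], goal_cases)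
      case (1 t1 \<tau>1)
      note f1 = frame_simps[OF 1(2), unfolded wr_Pop]
      have lay1: "layout \<tau>1" using layout_frame[OF 1(2)] lay by simp
      have p1: "lst ''S'' \<tau>1 = encode its" "lst ''X'' \<tau>1 = rev xs" "nreg \<tau>1 ''k'' = k" "t1 \<le> 40 * length xs + 40"
        using 1(1) by auto
      show ?case
      proof (rule wp_conseq[OF wp_Count[OF lay1]], goal_cases)
        case (1 t2 \<tau>2)
        note f2 = frame_simps[OF 1(2), unfolded wr_Count]
        have lay2: "layout \<tau>2" using layout_frame[OF 1(2)] lay1 by simp
        have p2: "nreg \<tau>2 ''nn'' = cntA xs" "nreg \<tau>2 ''mm'' = cntB xs"
          "0 < cntA xs \<Longrightarrow> nreg \<tau>2 ''u'' < nA \<and> nreg \<tau>2 ''u'' \<in> set xs"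
          "0 < cntB xs \<Longrightarrow> nreg \<tau>2 ''v'' + nA \<in> set xs" "t2 \<le> 40 * length xs + 20"
          using 1(1) unfolding p1(2) cnt by auto
        have S2: "lst ''S'' \<tau>2 = encode its" and X2: "lst ''X'' \<tau>2 = rev xs" and k2: "nreg \<tau>2 ''k'' = k"
          and dim2: "nreg \<tau>2 ''dim'' = d" and found2: "nreg \<tau>2 ''found'' = 0"
          using lay2 by (simp_all add: f2 f1 p1 found layout_def)
        consider "cntA xs = 0 \<or> cntB xs = 0" | "0 < cntA xs" "0 < cntB xs" "k = d"
          | "0 < cntA xs" "0 < cntB xs" "k < d" using V(1) by (fastforce simp: valid_def)
        then show ?case
        proof cases
          case 1
          then have "\<not> pair x y" if "{x, y} \<subseteq> set xs" for x y
            using that by (auto simp: pair_def filter_empty_conv not_le[symmetric])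
          then have cover': "pair x y \<Longrightarrow> \<exists>(ys, k)\<in>set its. {x, y} \<subseteq> set ys" for x y
            using cover by blast
          show ?thesis
            using 1 V cover' nonneg[of "cntA xs" "cntB xs" k] p1(4) p2(5)
            by (auto simp: p2(1,2) S2 found2 v intro!: exI[of _ "pot its + 10"] exI[of _ its])
        next
          case 2
          have "pair (nreg \<tau>2 ''u'') (nreg \<tau>2 ''v'' + nA)"
            using V(1) p2(3)[OF 2(1)] p2(4)[OF 2(2)] 2(3) by (auto simp: pair_def valid_def)
          then show ?thesis
            using 2 V nonneg[of "cntA xs" "cntB xs" k] p1(4) p2(5)
            by (auto simp: p2(1,2) S2 k2 dim2 v intro!: exI[of _ "pot its + 10"] exI[of _ its])
        next
          case 3
          let ?P = "(length xs + 1) * (r + d + 1)"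
          have "wp Split \<tau>2 (\<lambda>t \<rho>. \<exists>its'. lst ''S'' \<rho> = encode its' \<and> (\<forall>(xs, k)\<in>set its'. valid xs k) \<and>
              ?out its' \<rho> \<and> real t \<le> 1000 * real ?P \<and>
              pot its' + 2000 * real ?P \<le> pot its + \<Psi> (cntA xs) (cntB xs) k)"
          proof (rule wp_conseq[OF wp_Split[where r = r]], goal_cases)
            case (10 t3 \<tau>3)
            then obtain L p where L: "mset L = mset (rev xs)" "sorted_wrt (le k) L" "p < length L"
              "cntB L * cntA (take p L) + cntA L * cntB (take p L) < cntA L * cntB L"
              "cntA L * cntB L \<le> cntB L * cntA (take (Suc p) L) + cntA L * cntB (take (Suc p) L)"
              and S3: "lst ''S'' \<tau>3 = encode its @ take p L @ [p, k] @
                drop (Suc p) L @ [length L - Suc p, k] @ cross p L @ [length (cross p L), Suc k]"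
              and out: "(nreg \<tau>3 ''found'' = 0 \<and> (\<forall>y \<in> set L. \<not> pair y (L ! p) \<and> \<not> pair (L ! p) y) \<or>
                nreg \<tau>3 ''found'' = 1 \<and> pair (nreg \<tau>3 ''i'') (nreg \<tau>3 ''j'' + nA))"
              and t3: "t3 \<le> 1000 * ?P"
              unfolding X2 k2 S2 length_rev by blast
            have eq: "cntA L = cntA xs" "cntB L = cntB xs" "length L = length xs" "set L = set xs"
              using cnt_mset[OF L(1)] mset_eq_setD[OF L(1)] mset_eq_length[OF L(1)] by (simp_all add: cnt)
            have VL: "valid L k" using valid_mset[of L xs k] L(1) V(1) by simp
            define its' where "its' = its @ [(take p L, k), (drop (Suc p) L, k), (cross p L, Suc k)]"
            have "lst ''S'' \<tau>3 = encode its'"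
              using S3 L(3) by (simp add: its'_def encode_append) (simp add: encode_def)
            moreover have "\<forall>(xs, k)\<in>set its'. valid xs k"
              using V(2) valid_children[OF VL L(2,3) 3(3)] by (auto simp: its'_def)
            moreover have "?out its' \<tau>3"
            proof (cases "nreg \<tau>3 ''found'' = 1")
              case False
              then have no: "\<forall>y \<in> set L. \<not> pair y (L ! p) \<and> \<not> pair (L ! p) y" "nreg \<tau>3 ''found'' = 0"
                using out by auto
              have "\<exists>(ys, k)\<in>set its'. {x, y} \<subseteq> set ys" if xy: "pair x y" for x y
                using cover[OF xy]
              proof
                assume "{x, y} \<subseteq> set xs"
                then have "x \<in> set L" "y \<in> set L" by (auto simp: eq)
                moreover from this have "x \<noteq> L ! p" "y \<noteq> L ! p" using no xy by auto
                ultimately show ?thesis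
                  using pair_children[OF L(2,3) 3(3) xy] by (auto simp: its'_def)
              qed (auto simp: its'_def)
              then show ?thesis using no by auto
            qed (use out in auto)
            moreover have "pot its' + 2000 * real ?P \<le> pot its + \<Psi> (cntA xs) (cntB xs) k"
            proof -
              have "cntA xs \<le> nA" "cntB xs \<le> n - nA" using V(1) by (simp_all add: valid_def)
              then have "\<Psi> (cntA (take p L)) (cntB (take p L)) k
                  + \<Psi> (cntA (drop (Suc p) L)) (cntB (drop (Suc p) L)) k
                  + \<Psi> (cntA (drop (Suc p) L)) (cntB (take p L)) (Suc k)
                  + 3000 * real ((cntA xs + cntB xs + 1) * (r + d + 1)) \<le> \<Psi> (cntA xs) (cntB xs) k"
                using splits_cnt[OF L(3-5)] 3 unfolding eq by (intro decr)
              moreover have "pot its' = pot its + \<Psi> (cntA (take p L)) (cntB (take p L)) k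
                  + \<Psi> (cntA (drop (Suc p) L)) (cntB (drop (Suc p) L)) k
                  + \<Psi> (cntA (drop (Suc p) L)) (cntB (take p L)) (Suc k)
                  + 300 * (real (p + (length L - Suc p) + length (cross p L)) + 3)"
                using L(3) by (simp add: pot_def its'_def cnt_cross)
              moreover have "300 * (real (p + (length L - Suc p) + length (cross p L)) + 3) \<le> 1000 * real ?P"
              proof -
                have "length (cross p L) \<le> length (take p L) + length (drop (Suc p) L)"
                  unfolding cross_def length_append by (intro add_mono length_filter_le)
                then have "p + (length L - Suc p) + length (cross p L) + 3 \<le> 3 * (length xs + 1)"
                  using L(3) eq(3) by simp
                moreover have "(length xs + 1) * 1 \<le> ?P" by (intro mult_mono) auto
                moreover have "300 * (real y + 3) \<le> 1000 * real P" if "y + 3 \<le> 3 * (l + 1)" "(l + 1) * 1 \<le> P"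
                  for y l P :: nat
                proof -
                  have "real (300 * (y + 3)) \<le> real (1000 * P)"
                    using that by (subst of_nat_le_iff) simp
                  then show ?thesis by simp
                qed
                ultimately show ?thesis by blast
              qed
              ultimately show ?thesis unfolding cntA_cntB by linarith
            qed
            moreover have "real t3 \<le> 1000 * real ?P" using t3 by linarith
            ultimately show ?case by blast
          qed (use 3 V(1) len found2 lay2 in \<open>auto simp: X2 k2 cnt p2 valid_def\<close>)
          then show ?thesis
            unfolding wp_Cond using 3 p2(1,2) k2 dim2
          proof (simp, elim wp_mono, goal_cases)
            case (1 t3 \<tau>3)
            then obtain its' where its': "lst ''S'' \<tau>3 = encode its'" "\<forall>(xs, k)\<in>set its'. valid xs k"
              "?out its' \<tau>3" "real t3 \<le> 1000 * real ?P"
              "pot its' + 2000 * real ?P \<le> pot its + \<Psi> (cntA xs) (cntB xs) k" by auto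
            have "real (length xs + 1) \<le> real ?P" by (rule of_nat_mono) simp
            then have "real (length xs) + 1 \<le> real ?P"
              unfolding of_nat_add[of "length xs" 1] of_nat_1 .
            moreover have "real t1 \<le> 40 * real (length xs) + 40" "real t2 \<le> 40 * real (length xs) + 20"
              using p1(4) p2(5) by linarith+
            moreover have "t1' + t2' + t3' + q + 60 \<le> e + c + 300 * (l + 1) + 10"
              if "l + 1 \<le> P" "t1' \<le> 40 * l + 40" "t2' \<le> 40 * l + 20" "t3' \<le> 1000 * P"
                "q + 2000 * P \<le> e + c" "0 \<le> l" for l P t1' t2' t3' q e c :: real
              using that by simp
            ultimately have "real t1 + real t2 + real t3 + pot its' + 60 \<le> v"
              using its'(4,5) unfolding v by (meson of_nat_0_le_iff)
            then show ?case using its'(1-3) by (intro exI[of _ "pot its' + 10"] conjI exI[of _ its']) auto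
          qed
        qed
      qed
    qed
  next
    case (3 v \<tau>)
    then show ?case using pot_nonneg by auto
  next
    case (4 t v' \<tau>)
    then obtain its where its: "lst ''S'' \<tau> = encode its" "?out its \<tau>" by blast
    show ?case
    proof (cases "nreg \<tau> ''found'' = 0")
      case True
      then have "nreg \<tau> ''S'' = 0" using 4(3) by simp
      then have "its = []" using its(1) encode_eq_Nil[of its] length_lst[of \<tau> "''S''"] by auto
      then show ?thesis using its(2) True 4(4) by simp
    next
      case False
      then show ?thesis using its(2) 4(4) by simp
    qed
  qed
qed

end
section \<open>Preparing the memory\<close>

text \<open>
  \<open>B\<close> is appended to the array \<open>A\<close>. As there is no multiplication of naturals, the addresses \<open>x * d\<close>
  are tabulated in the list \<open>o\<close>, up to \<open>x = n\<close>: this makes both the start of \<open>B\<close> and the end of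
  the input available even if one of the sets is empty.
\<close>

definition Setup :: com where
  "Setup = (
    NAssign ''n'' (NAdd (NReg ''sizeA'') (NReg ''sizeB'')) ;;
    NAssign ''c'' (NConst 0) ;;
    While (NLess (NReg ''o'') (NAdd (NReg ''n'') (NConst 1))) (
      Push ''o'' (NReg ''c'') ;; NAssign ''c'' (NAdd (NReg ''c'') (NReg ''dim''))) ;;
    NAssign ''p'' (NArr ''o'' (NReg ''sizeA'')) ;;
    NAssign ''q'' (NConst 0) ;;
    While (NLess (NReg ''p'') (NArr ''o'' (NReg ''n''))) (
      RStore ''A'' (NReg ''p'') (RArr ''B'' (NReg ''q'')) ;; incr ''p'' ;; incr ''q'') ;;
    While (NLess (NReg ''S'') (NReg ''n'')) (Push ''S'' (NReg ''S'')) ;;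
    Push ''S'' (NReg ''n'') ;; Push ''S'' (NConst 0))"

lemma wp_offsets:
  assumes "lst ''o'' \<sigma> = []" "nreg \<sigma> ''c'' = 0"
  shows "wp (While (NLess (NReg ''o'') (NAdd (NReg ''n'') (NConst 1))) (
      Push ''o'' (NReg ''c'') ;; NAssign ''c'' (NAdd (NReg ''c'') (NReg ''dim'')))) \<sigma>
    (\<lambda>t \<tau>. lst ''o'' \<tau> = map (\<lambda>x. x * nreg \<sigma> ''dim'') [0..<nreg \<sigma> ''n'' + 1] \<and> t \<le> 20 * nreg \<sigma> ''n'' + 40)"
proof -
  define n d where "n = nreg \<sigma> ''n''" "d = nreg \<sigma> ''dim''"
  note defs = this
  show ?thesis
  proof (rule wp_While_measure[where I = "\<lambda>\<tau>. nreg \<tau> ''o'' \<le> n + 1 \<and> nreg \<tau> ''c'' = nreg \<tau> ''o'' * d \<and>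
        lst ''o'' \<tau> = map (\<lambda>x. x * d) [0..<nreg \<tau> ''o'']"
      and V = "\<lambda>\<tau>. 20 * (n + 1 - nreg \<tau> ''o'') + 10"], goal_cases)
    case 1
    then show ?case using assms length_lst[of \<sigma> "''o''"] by simp
  next
    case (2 \<tau>)
    have fr: "nreg \<tau> ''n'' = n" "nreg \<tau> ''dim'' = d" using frame_simps[OF 2(2)] by (simp_all add: defs)
    show ?case using 2(1,3) by (simp add: fr)
  next
    case (3 \<tau>)
    then show ?case by simp
  next
    case (4 t \<tau>)
    have fr: "nreg \<tau> ''n'' = n" using frame_simps[OF 4(2)] by (simp_all add: defs)
    have "nreg \<tau> ''o'' = Suc n" using 4(1,3) by (simp add: fr)
    then show ?case using 4(1,4) by (simp add: defs)
  qed
qed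

lemma flat_append1: "m < length xs * d \<Longrightarrow> flat d (xs @ ys) m = flat d xs m"
  by (simp add: flat_def nth_append less_mult_imp_div_less algebra_simps)

lemma flat_append2: "length xs * d \<le> m \<Longrightarrow> flat d (xs @ ys) m = flat d ys (m - length xs * d)"
proof (cases "d = 0")
  case False
  assume m: "length xs * d \<le> m"
  then obtain i where i: "m = length xs * d + i" using le_Suc_ex by blast
  show ?thesis
    using False by (auto simp: i flat_def nth_append algebra_simps div_mult_self3)
qed (simp add: flat_def)

lemma flat_nth: "x < length xs \<Longrightarrow> k < d \<Longrightarrow> flat d xs (x * d + k) = xs ! x ! k"
proof -
  assume *: "x < length xs" "k < d"
  then have "x * d + k < Suc x * d" by simp
  also have "\<dots> \<le> length xs * d" using *(1) by (intro mult_le_mono1) simp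
  finally show ?thesis using *(2) by (simp add: flat_def)
qed

lemma wp_copy_input:
  assumes "nreg \<sigma> ''p'' = length xs * d" "nreg \<sigma> ''q'' = 0"
    "narr \<sigma> ''o'' (nreg \<sigma> ''n'') = (length xs + length ys) * d"
    "rarr \<sigma> ''A'' = flat d xs" "rarr \<sigma> ''B'' = flat d ys"
  shows "wp (While (NLess (NReg ''p'') (NArr ''o'' (NReg ''n''))) (
      RStore ''A'' (NReg ''p'') (RArr ''B'' (NReg ''q'')) ;; incr ''p'' ;; incr ''q'')) \<sigma>
    (\<lambda>t \<tau>. (\<forall>m<(length xs + length ys) * d. rarr \<tau> ''A'' m = flat d (xs @ ys) m) \<and>
      t \<le> 30 * (length ys * d) + 10)"
proof (rule wp_While_measure[where I = "\<lambda>\<tau>. length xs * d \<le> nreg \<tau> ''p'' \<and>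
      nreg \<tau> ''q'' = nreg \<tau> ''p'' - length xs * d \<and>
      (\<forall>m<nreg \<tau> ''p''. rarr \<tau> ''A'' m = flat d (xs @ ys) m)"
    and V = "\<lambda>\<tau>. 30 * ((length xs + length ys) * d - nreg \<tau> ''p'') + 10"], goal_cases)
  case 1
  then show ?case using assms by (simp add: flat_append1)
next
  case (2 \<tau>)
  have fr: "nreg \<tau> ''n'' = nreg \<sigma> ''n''" "narr \<tau> ''o'' = narr \<sigma> ''o''" "rarr \<tau> ''B'' = rarr \<sigma> ''B''"
    using frame_simps[OF 2(2)] by simp_all
  define N where "N = (length xs + length ys) * d"
  have p: "nreg \<tau> ''p'' < N" using 2(3) by (simp add: fr assms N_def)
  show ?case unfolding N_def[symmetric] using 2(1) p
    by (auto simp: fr assms flat_append2 less_Suc_eq Suc_diff_le)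
next
  case (3 \<tau>)
  then show ?case by simp
next
  case (4 t \<tau>)
  have fr: "nreg \<tau> ''n'' = nreg \<sigma> ''n''" "narr \<tau> ''o'' = narr \<sigma> ''o''"
    using frame_simps[OF 4(2)] by simp_all
  show ?case using 4(1,3,4) assms(1) by (auto simp: fr assms(3) add_mult_distrib)
qed

lemma wp_init_stack:
  assumes "lst ''S'' \<sigma> = []"
  shows "wp (While (NLess (NReg ''S'') (NReg ''n'')) (Push ''S'' (NReg ''S''))) \<sigma>
    (\<lambda>t \<tau>. lst ''S'' \<tau> = [0..<nreg \<sigma> ''n''] \<and> nreg \<tau> ''S'' = nreg \<sigma> ''n'' \<and> t \<le> 20 * nreg \<sigma> ''n'' + 10)"
proof (rule wp_While_measure[where I = "\<lambda>\<tau>. nreg \<tau> ''S'' \<le> nreg \<sigma> ''n'' \<and> lst ''S'' \<tau> = [0..<nreg \<tau> ''S'']"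
    and V = "\<lambda>\<tau>. 20 * (nreg \<sigma> ''n'' - nreg \<tau> ''S'') + 10"], goal_cases)
  case 1
  then show ?case using assms length_lst[of \<sigma> "''S''"] by simp
next
  case (2 \<tau>)
  then show ?case using frame_nreg[OF 2(2), of "''n''"] by simp
next
  case (3 \<tau>)
  then show ?case by simp
next
  case (4 t \<tau>)
  then show ?case using frame_nreg[OF 4(2), of "''n''"] assms length_lst[of \<sigma> "''S''"] by auto
qed

lemma wp_Setup:
  fixes xs ys :: "real list list" and d :: nat
  defines "n \<equiv> length xs + length ys"
  shows "wp Setup (input_state d xs ys) (\<lambda>t \<tau>.
    points.layout (length xs) n d (\<lambda>x k. (xs @ ys) ! x ! k) \<tau> \<and>
    lst ''S'' \<tau> = [0..<n] @ [n, 0] \<and> nreg \<tau> ''found'' = 0 \<and> t \<le> 200 * ((n + 1) * (d + 1)))"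
proof -
  have i: "nreg (input_state d xs ys) ''dim'' = d" "nreg (input_state d xs ys) ''sizeA'' = length xs"
    "nreg (input_state d xs ys) ''sizeB'' = length ys" "lst ''o'' (input_state d xs ys) = []"
    "lst ''S'' (input_state d xs ys) = []" "nreg (input_state d xs ys) ''found'' = 0"
    "rarr (input_state d xs ys) ''A'' = flat d xs" "rarr (input_state d xs ys) ''B'' = flat d ys"
    by (simp_all add: input_state_def lst_def)
  show ?thesis
    unfolding Setup_def wp_Seq wp_NAssign wp_Push
  proof (rule wp_conseq[OF wp_offsets], goal_cases)
    case (3 t1 \<tau>1)
    note f1 = frame_simps[OF 3(2), simplified]
    have o1: "lst ''o'' \<tau>1 = map (\<lambda>x. x * d) [0..<n + 1]" and t1: "t1 \<le> 20 * n + 40" using 3(1) by (simp_all add: i n_def)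
    have o1': "narr \<tau>1 ''o'' x = x * d" if "x \<le> n" for x
      using that by (subst narr_lst) (auto simp: o1 nth_append)
    have r1: "nreg \<tau>1 ''n'' = n" "nreg \<tau>1 ''sizeA'' = length xs" "nreg \<tau>1 ''dim'' = d" "lst ''S'' \<tau>1 = []"
      "rarr \<tau>1 ''A'' = flat d xs" "rarr \<tau>1 ''B'' = flat d ys" "nreg \<tau>1 ''found'' = 0"
      by (simp_all add: f1 i n_def)
    show ?case
    proof (rule wp_conseq[OF wp_copy_input[of _ xs d ys]], goal_cases)
      case (6 t2 \<tau>2)
      note f2 = frame_simps[OF 6(2), simplified]
      have A: "\<forall>m<n * d. rarr \<tau>2 ''A'' m = flat d (xs @ ys) m" and t2: "t2 \<le> 30 * (length ys * d) + 10"
        using 6(1) by (simp_all add: n_def)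
      show ?case
      proof (rule wp_conseq[OF wp_init_stack], goal_cases)
        case (2 t3 \<tau>3)
        note f3 = frame_simps[OF 2(2), simplified]
        have S: "lst ''S'' \<tau>3 = [0..<n]" "nreg \<tau>3 ''n'' = n" and t3: "t3 \<le> 20 * n + 10"
          using 2(1) by (simp_all add: f3 f2 r1)
        have "rarr \<tau>3 ''A'' (narr \<tau>3 ''o'' x + k) = (xs @ ys) ! x ! k" if "x < n" "k < d" for x k
        proof -
          have "x * d + k < Suc x * d" using that by simp
          also have "\<dots> \<le> n * d" using that by (intro mult_le_mono1) simp
          finally have "x * d + k < n * d" .
          then show ?thesis using A that flat_nth[of x "xs @ ys" k d] by (simp add: f3 f2 o1' n_def)
        qed
        then have "points.layout (length xs) n d (\<lambda>x k. (xs @ ys) ! x ! k) \<tau>3"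
          by (simp add: points.layout_def f3 f2 r1)
        moreover have "length ys * d \<le> (n + 1) * (d + 1)" by (intro mult_le_mono) (simp_all add: n_def)
        moreover have "(n + 1) * 1 \<le> (n + 1) * (d + 1)" by (intro mult_le_mono) simp_all
        ultimately show ?case using S t1 t2 t3 by (simp add: points.layout_setN points.layout_push f3 f2 r1)
      qed (simp add: f2 r1)
    qed (simp_all add: r1 o1' n_def)
  qed (simp_all add: i)
qed

definition Program :: com where
  "Program = Setup ;; Main"

lemma wp_Program:
  fixes \<Psi> :: "nat \<Rightarrow> nat \<Rightarrow> nat \<Rightarrow> real" and xs ys :: "real list list"
  defines "nA \<equiv> length xs" and "nB \<equiv> length ys"
  assumes dim: "\<And>u. u \<in> set xs \<union> set ys \<Longrightarrow> length u = d"
    and nonneg: "\<And>a b k. 0 \<le> \<Psi> a b k"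
    and decr: "\<And>k nn mm a b a' b'. k < d \<Longrightarrow> 0 < nn \<Longrightarrow> 0 < mm \<Longrightarrow> nn \<le> nA \<Longrightarrow> mm \<le> nB \<Longrightarrow>
      points.splits nn mm a b a' b' \<Longrightarrow>
      \<Psi> a b k + \<Psi> a' b' k + \<Psi> a' b (Suc k) + 3000 * real ((nn + mm + 1) * (r + d + 1)) \<le> \<Psi> nn mm k"
    and r: "nA + nB \<le> 2 ^ r"
  shows "\<exists>t \<tau>. exec Program (input_state d xs ys) t \<tau> \<and> correct_output xs ys \<tau> \<and>
    real t \<le> \<Psi> nA nB 0 + 600 * real ((nA + nB + 1) * (d + 1))"
proof -
  define cd where "cd = (\<lambda>x k. (xs @ ys) ! x ! k)"
  interpret points nA "nA + nB" d cd .
  have pair: "pair x (y + nA) \<longleftrightarrow> x < nA \<and> y < nB \<and> dominates (xs ! x) (ys ! y)" for x y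
    unfolding pair_def using dim[of "xs ! x"] dim[of "ys ! y"]
    by (auto simp: dominates_def cd_def nth_append nA_def nB_def)
  have "wp Program (input_state d xs ys) (\<lambda>t \<tau>. correct_output xs ys \<tau> \<and>
    real t \<le> \<Psi> nA nB 0 + 600 * real ((nA + nB + 1) * (d + 1)))"
    unfolding Program_def wp_Seq
  proof (rule wp_conseq[OF wp_Setup], goal_cases)
    case (1 t1 \<tau>1)
    show ?case
    proof (rule wp_conseq[OF wp_Main[where \<Psi> = \<Psi> and r = r]], goal_cases)
      case (8 t2 \<tau>2)
      have t2: "real t2 \<le> \<Psi> nA nB 0 + 300 * (real (nA + nB) + 1) + 10" using 8(1) by simp
      have "correct_output xs ys \<tau>2"
      proof (cases "nreg \<tau>2 ''found'' = 1")
        case True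
        then show ?thesis using 8(1) pair by (auto simp: correct_output_def nA_def nB_def)
      next
        case False
        then have "\<not> pair x (y + nA)" "nreg \<tau>2 ''found'' = 0" for x y using 8(1) by auto
        then show ?thesis using pair by (auto simp: correct_output_def nA_def nB_def in_set_conv_nth)
      qed
      moreover have "(nA + nB + 1) * 1 \<le> (nA + nB + 1) * (d + 1)" by (intro mult_le_mono) simp_all
      then have "t1 + 300 * (nA + nB + 1) + 10 \<le> 600 * ((nA + nB + 1) * (d + 1))"
        using 1(1) by (simp add: nA_def nB_def)
      then have "real t1 + 300 * (real (nA + nB) + 1) + 10 \<le> 600 * real ((nA + nB + 1) * (d + 1))"
        using of_nat_mono[where ?'a = real] by fastforce
      ultimately show ?case using t2 by simp
    qed (use 1(1) nonneg decr r in \<open>auto simp: cd_def nA_def nB_def\<close>)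
  qed
  then show ?thesis by (auto simp: wp_def)
qed

section \<open>The recurrence\<close>

text \<open>Weighted inequality of arithmetic and geometric mean: use \<open>ln t <= t - 1\<close>
  at the ratios of \<open>a\<close> and \<open>b\<close> to their weighted geometric mean
  \<open>M\<close>; the logarithms cancel as \<alpha> + \<beta> = 1.\<close>

lemma young_powr:
  fixes a b \<alpha> \<beta> :: real
  assumes "0 \<le> a" "0 \<le> b" "0 < \<alpha>" "0 < \<beta>" "\<alpha> + \<beta> = 1"
  shows "a powr \<alpha> * b powr \<beta> \<le> \<alpha> * a + \<beta> * b"
proof (cases "a = 0 \<or> b = 0")
  case True
  then show ?thesis using assms by auto
next
  case False
  then have ab: "0 < a" "0 < b" using assms by auto
  define M where "M = a powr \<alpha> * b powr \<beta>"
  have M: "0 < M" using ab by (simp add: M_def)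
  have "ln M = \<alpha> * ln a + \<beta> * ln b" using ab by (simp add: M_def ln_mult ln_powr)
  moreover have "ln a - ln M \<le> a / M - 1" "ln b - ln M \<le> b / M - 1"
    using ln_le_minus_one[of "a / M"] ln_le_minus_one[of "b / M"] ab M by (simp_all add: ln_div)
  then have "\<alpha> * (ln a - ln M) + \<beta> * (ln b - ln M) \<le> \<alpha> * (a / M - 1) + \<beta> * (b / M - 1)"
    using assms(3,4) by (intro add_mono mult_left_mono) auto
  moreover have "\<alpha> * (ln a - ln M) + \<beta> * (ln b - ln M) = \<alpha> * ln a + \<beta> * ln b - (\<alpha> + \<beta>) * ln M"
    by (simp add: algebra_simps)
  moreover have "\<alpha> * (a / M - 1) + \<beta> * (b / M - 1) = (\<alpha> * a + \<beta> * b) / M - (\<alpha> + \<beta>)"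
    by (simp add: algebra_simps add_divide_distrib)
  ultimately have "1 \<le> (\<alpha> * a + \<beta> * b) / M" using assms(5) by simp
  then show ?thesis using M by (simp add: M_def[symmetric] field_simps)
qed

text \<open>The reason for taking \<theta> as a fourth power: estimating
  \<open>ln (1 / \<eta>)\<close> by \<open>1 / \<eta>\<close> costs one factor \<eta>, so the
  exponent \<open>- \<theta> * ln \<theta>\<close> is at most \<open>4 * \<eta>^3\<close>.\<close>

lemma powr_self_bound:
  fixes \<eta> :: real
  assumes "0 < \<eta>" "\<eta> \<le> 1/6"
  shows "(\<eta>^4) powr (- (\<eta>^4)) \<le> 1 + 8 * \<eta>^3"
proof -
  have "ln (1 / \<eta>) \<le> 1 / \<eta>" using ln_le_minus_one[of "1/\<eta>"] assms by simp
  then have *: "\<eta>^4 * (4 * ln (1 / \<eta>)) \<le> \<eta>^4 * (4 * (1 / \<eta>))" using assms by (intro mult_left_mono) auto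
  then have le: "- (\<eta>^4) * ln (\<eta>^4) \<le> 4 * \<eta>^3"
  proof -
    have "ln (\<eta>^4) = 4 * ln \<eta>" "ln (1 / \<eta>) = - ln \<eta>" using assms by (simp_all add: ln_realpow ln_div)
    then have "- (\<eta>^4) * ln (\<eta>^4) = \<eta>^4 * (4 * ln (1 / \<eta>))" by simp
    also note *
    also have "\<eta>^4 * (4 * (1 / \<eta>)) = 4 * \<eta>^3"
      using assms by (simp add: power4_eq_xxxx power3_eq_cube)
    finally show ?thesis .
  qed
  have "\<eta>^3 \<le> (1/6)^3" using assms by (intro power_mono) auto
  then have small: "4 * \<eta>^3 \<le> 1" by (simp add: power3_eq_cube)
  have "(\<eta>^4) powr (- (\<eta>^4)) \<le> exp (4 * \<eta>^3)" using assms le by (simp add: powr_def)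
  also have "\<dots> \<le> 1 + 4 * \<eta>^3 + (4 * \<eta>^3)^2" using assms small by (intro exp_bound) auto
  also have "(4 * \<eta>^3)^2 \<le> 4 * \<eta>^3"
    using mult_left_le[OF small, of "4 * \<eta>^3"] assms unfolding power2_eq_square by simp
  finally show ?thesis by simp
qed

text \<open>The constant 201 in \<mu> is the sum of 100 for the bound on \<open>A^2\<close>, 1 for
  the bound on \<open>4 * \<theta>^2\<close>, and 100 for the gain that remains.\<close>

lemma split_weights:
  fixes \<eta> h x y z :: real
  defines "\<theta> \<equiv> \<eta>^4" and "\<mu> \<equiv> 201 * \<eta>^6"
  assumes \<eta>: "0 < \<eta>" "\<eta> \<le> 1/6" and h: "0 \<le> h" "h \<le> 1"
    and "0 \<le> x" "x \<le> h * (1 - h)" "0 \<le> y" "y \<le> h * (1 - h)" "0 \<le> z" "z \<le> h * h"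
  shows "x powr (1 - \<theta>) + y powr (1 - \<theta>) + (1 - \<mu>) * z powr (1 - \<theta>) \<le> 1 - 100 * \<eta>^6"
proof -
  define \<delta> g where "\<delta> = 8 * \<eta>^3" "g = 1 - h"
  note defs = this
  have \<eta>3: "201 * \<eta>^3 \<le> 1"
  proof -
    have "\<eta>^3 \<le> (1/6)^3" using \<eta> by (intro power_mono) auto
    then show ?thesis by (simp add: power3_eq_cube)
  qed
  have \<eta>6: "\<eta>^6 = \<eta>^3 * \<eta>^3" "\<eta>^4 = \<eta>^3 * \<eta>" by (simp_all add: power_add[symmetric] power_Suc2[symmetric])
  have \<eta>3': "0 < \<eta>^3" using \<eta> by simp
  have \<mu>: "0 < \<mu>" "\<mu> \<le> \<eta>^3"
  proof -
    show "0 < \<mu>" using \<eta> by (simp add: \<mu>_def)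
    have "(201 * \<eta>^3) * \<eta>^3 \<le> 1 * \<eta>^3" using \<eta>3 \<eta>3' by (intro mult_right_mono) auto
    then show "\<mu> \<le> \<eta>^3" unfolding \<mu>_def \<eta>6(1) by (simp only: mult.assoc mult_1_left)
  qed
  have \<theta>: "0 < \<theta>" "\<theta> \<le> \<eta>^3"
  proof -
    show "0 < \<theta>" using \<eta> by (simp add: \<theta>_def)
    have "\<eta>^3 * \<eta> \<le> \<eta>^3 * 1" using \<eta> \<eta>3' by (intro mult_left_mono) auto
    then show "\<theta> \<le> \<eta>^3" unfolding \<theta>_def \<eta>6(2) by (simp only: mult_1_right)
  qed
  have \<delta>: "0 < \<delta>" "\<delta> \<le> 1" using \<eta>3 \<eta>3' by (auto simp: defs)
  have \<theta>1: "\<theta> < 1" "\<mu> < 1" using \<theta> \<mu> \<eta>3 by linarith+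
  \<comment> \<open>The second base in Young's inequality is \<theta>, which makes the additive
    error \<theta>^2, of order \<eta>^8. With base 1 it would be \<theta>, more than \<mu> can
    compensate.\<close>
  have xy: "w powr (1 - \<theta>) \<le> (1 + \<delta>) * (h * (1 - h) + \<theta>^2)" if "0 \<le> w" "w \<le> h * (1 - h)" for w
  proof -
    have "w powr (1 - \<theta>) * \<theta> powr \<theta> \<le> (1 - \<theta>) * w + \<theta> * \<theta>"
      using that \<theta> \<theta>1 by (intro young_powr) auto
    also have "\<dots> \<le> w + \<theta>^2" using that \<theta> by (simp add: power2_eq_square algebra_simps)
    finally have "w powr (1 - \<theta>) * \<theta> powr \<theta> * \<theta> powr (-\<theta>) \<le> (w + \<theta>^2) * \<theta> powr (-\<theta>)"
      by (intro mult_right_mono) auto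
    then have "w powr (1 - \<theta>) \<le> \<theta> powr (-\<theta>) * (w + \<theta>^2)"
      using \<theta> by (simp add: powr_minus field_simps)
    also have "\<dots> \<le> (1 + \<delta>) * (h * (1 - h) + \<theta>^2)"
      using that powr_self_bound[OF \<eta>] \<delta> by (intro mult_mono) (auto simp: \<theta>_def defs)
    finally show ?thesis .
  qed
  \<comment> \<open>Here base 1 is good enough: the error \<open>\<theta> * (1 - h^2)\<close> is at
    most \<open>2 * \<theta> * g\<close> and joins the terms linear in \<open>g\<close>.\<close>
  have z: "z powr (1 - \<theta>) \<le> (1 - \<theta>) * h^2 + \<theta>"
  proof -
    have "z powr (1 - \<theta>) \<le> (h^2) powr (1 - \<theta>)"
      using assms \<theta>1 by (intro powr_mono2) (auto simp: power2_eq_square)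
    also have "\<dots> \<le> (1 - \<theta>) * h^2 + \<theta> * 1"
      using young_powr[of "h^2" 1 "1 - \<theta>" \<theta>] \<theta> \<theta>1 by simp
    finally show ?thesis by simp
  qed
  define A where "A = \<delta> + \<mu> + \<theta>"
  have g: "0 \<le> g" "g \<le> 1" "h = 1 - g" using h by (auto simp: defs)
  have "x powr (1 - \<theta>) + y powr (1 - \<theta>) + (1 - \<mu>) * z powr (1 - \<theta>)
      \<le> 2 * ((1 + \<delta>) * (h * (1 - h) + \<theta>^2)) + (1 - \<mu>) * ((1 - \<theta>) * h^2 + \<theta>)"
    using xy[of x] xy[of y] assms mult_left_mono[OF z, of "1 - \<mu>"] \<theta>1 by linarith
  also have "\<dots> = 1 - \<mu> + 2 * (A - \<mu> * \<theta>) * g - (1 + 2 * \<delta> + (\<mu> + \<theta> - \<mu> * \<theta>)) * g^2 + 2 * (1 + \<delta>) * \<theta>^2"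
    unfolding g(3) A_def by (simp add: algebra_simps power2_eq_square)
  also have "\<dots> \<le> 1 - \<mu> + 2 * A * g - g^2 + 4 * \<theta>^2"
  proof -
    have "0 \<le> \<mu> * \<theta> * g" using \<mu> \<theta> g by simp
    moreover have "\<mu> * \<theta> \<le> \<theta>" using \<mu> \<theta> \<theta>1 by (simp add: mult_left_le_one_le)
    then have "1 * g^2 \<le> (1 + 2 * \<delta> + (\<mu> + \<theta> - \<mu> * \<theta>)) * g^2"
      using \<delta> \<mu> by (intro mult_right_mono) auto
    moreover have "(1 + \<delta>) * \<theta>^2 \<le> 2 * \<theta>^2" using \<delta> by (intro mult_right_mono) auto
    ultimately show ?thesis by (simp add: algebra_simps)
  qed
  finally have "x powr (1 - \<theta>) + y powr (1 - \<theta>) + (1 - \<mu>) * z powr (1 - \<theta>)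
    \<le> 1 - \<mu> + 2 * A * g - g^2 + 4 * \<theta>^2" .
  \<comment> \<open>Completing the square: the quadratic gain reduces a loss linear in
    \<open>A\<close> to \<open>A^2\<close>, of order \<eta>^6 although \<open>A\<close> has order
    \<eta>^3.\<close>
  moreover have "2 * A * g - g^2 \<le> A^2"
    using zero_le_power2[of "A - g"] by (simp add: power2_eq_square algebra_simps)
  moreover have "A^2 \<le> 100 * \<eta>^6"
  proof -
    have "A \<le> 10 * \<eta>^3" "0 \<le> A" using \<mu> \<theta> \<delta> by (auto simp: A_def defs)
    then have "A^2 \<le> (10 * \<eta>^3)^2" by (intro power_mono)
    then show ?thesis by (simp add: power_mult_distrib power_mult[symmetric])
  qed
  moreover have "4 * \<theta>^2 \<le> \<eta>^6"
  proof -
    have "\<eta>^2 \<le> (1/6)^2" using \<eta> by (intro power_mono) auto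
    then have "4 * \<eta>^2 * \<eta>^6 \<le> 1 * \<eta>^6" using \<eta> by (intro mult_right_mono) (auto simp: power2_eq_square)
    moreover have "\<theta>^2 = \<eta>^2 * \<eta>^6" by (simp add: \<theta>_def power_mult[symmetric] power_add[symmetric])
    ultimately show ?thesis by (simp only: mult.assoc mult_1_left)
  qed
  ultimately show ?thesis unfolding \<mu>_def by linarith
qed

lemma splits_powr:
  fixes \<eta> :: real
  defines "\<theta> \<equiv> \<eta>^4"
  assumes \<eta>: "0 < \<eta>" "\<eta> \<le> 1/6"
    and s: "points.splits nn mm a b a' b'" and pos: "0 < nn" "0 < mm"
  shows "real (a * b) powr (1 - \<theta>) + real (a' * b') powr (1 - \<theta>) + (1 - 201 * \<eta>^6) * real (a' * b) powr (1 - \<theta>)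
    \<le> (1 - 100 * \<eta>^6) * real (nn * mm) powr (1 - \<theta>)"
proof -
  define \<alpha> \<beta> \<alpha>' \<beta>' where "\<alpha> = real a / nn" "\<beta> = real b / mm" "\<alpha>' = real a' / nn" "\<beta>' = real b' / mm"
  note defs = this
  have nn: "0 \<le> \<alpha>" "0 \<le> \<beta>" "0 \<le> \<alpha>'" "0 \<le> \<beta>'" by (simp_all add: defs)
  have sum: "\<alpha> + \<beta> \<le> 1" "\<alpha>' + \<beta>' \<le> 1"
  proof -
    have "real (mm * a + nn * b) \<le> real (nn * mm)" "real (mm * a' + nn * b') \<le> real (nn * mm)"
      using s unfolding points.splits_def of_nat_le_iff by auto
    then show "\<alpha> + \<beta> \<le> 1" "\<alpha>' + \<beta>' \<le> 1" using pos by (simp_all add: defs field_simps)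
  qed
  have "a + a' = nn \<or> b + b' = mm" using s by (simp add: points.splits_def)
  then have "\<alpha> + \<alpha>' = 1 \<or> \<beta> + \<beta>' = 1"
    using pos unfolding defs add_divide_distrib[symmetric] of_nat_add[symmetric] by auto
  \<comment> \<open>\<open>h\<close> is \<alpha>' in the first case and \<beta> in the second; the
    fractions of one set sum to 1, and \<open>sum\<close> then bounds those of the other.\<close>
  then obtain h where h: "0 \<le> h" "h \<le> 1" "\<alpha> \<le> 1 - h" "\<beta> \<le> h" "\<alpha>' \<le> h" "\<beta>' \<le> 1 - h"
  proof
    assume "\<alpha> + \<alpha>' = 1"
    then show ?thesis using that[of \<alpha>'] nn sum by auto
  next
    assume "\<beta> + \<beta>' = 1"
    then show ?thesis using that[of \<beta>] nn sum by auto
  qed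
  have prods: "\<alpha> * \<beta> \<le> h * (1 - h)" "\<alpha>' * \<beta>' \<le> h * (1 - h)" "\<alpha>' * \<beta> \<le> h * h"
    using mult_mono[of \<beta> h \<alpha> "1 - h"] mult_mono[of \<alpha>' h \<beta>' "1 - h"] mult_mono[of \<alpha>' h \<beta> h] h nn
    by (auto simp: mult.commute)
  have main: "(\<alpha> * \<beta>) powr (1 - \<theta>) + (\<alpha>' * \<beta>') powr (1 - \<theta>) + (1 - 201 * \<eta>^6) * (\<alpha>' * \<beta>) powr (1 - \<theta>)
      \<le> 1 - 100 * \<eta>^6"
    unfolding \<theta>_def using prods h nn by (intro split_weights[OF \<eta> h(1,2)]) auto
  define w where "w = real (nn * mm) powr (1 - \<theta>)"
  have scale: "real (u * v) powr (1 - \<theta>) = w * (real u / nn * (real v / mm)) powr (1 - \<theta>)" for u v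
    using pos by (simp add: w_def powr_mult[symmetric])
  have "w * ((\<alpha> * \<beta>) powr (1 - \<theta>) + (\<alpha>' * \<beta>') powr (1 - \<theta>) + (1 - 201 * \<eta>^6) * (\<alpha>' * \<beta>) powr (1 - \<theta>))
      \<le> w * (1 - 100 * \<eta>^6)"
    using main by (intro mult_left_mono) (auto simp: w_def)
  then show ?thesis unfolding scale[of a b] scale[of a' b'] scale[of a' b] w_def[symmetric] defs[symmetric]
    by (simp add: algebra_simps)
qed

section \<open>The potential and the total running time\<close>

text \<open>\<open>R\<close> is the cost per point of splitting a subproblem.\<close>

definition potential :: "real \<Rightarrow> real \<Rightarrow> nat \<Rightarrow> nat \<Rightarrow> nat \<Rightarrow> nat \<Rightarrow> nat \<Rightarrow> real" where
  "potential \<eta> N R d a b k = 90 * real R / \<eta>^6 * N powr (\<eta>^4) * real (a * b) powr (1 - \<eta>^4) *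
     (1 / (1 - 201 * \<eta>^6)) ^ (d - k)"

lemma eta_small:
  fixes \<eta> :: real
  assumes "0 < \<eta>" "\<eta> \<le> 1/6"
  shows "\<eta>^4 < 1" "201 * \<eta>^6 \<le> 1/2"
proof -
  have "\<eta>^4 \<le> (1/6)^4" "\<eta>^6 \<le> (1/6)^6" using assms by (intro power_mono; simp)+
  moreover have "(1/6)^4 < (1::real)" "201 * (1/6)^6 \<le> (1/2::real)" by (simp_all add: eval_nat_numeral)
  ultimately show "\<eta>^4 < 1" "201 * \<eta>^6 \<le> 1/2" by linarith+
qed

lemma potential_nonneg:
  assumes "0 < \<eta>" "\<eta> \<le> 1/6"
  shows "0 \<le> potential \<eta> N R d a b k"
  using eta_small[OF assms] assms by (simp add: potential_def)

lemma potential_decreases: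
  assumes \<eta>: "0 < \<eta>" "\<eta> \<le> 1/6" and k: "k < d" and pos: "0 < nn" "0 < mm"
    and N: "real nn \<le> N" "real mm \<le> N" and s: "points.splits nn mm a b a' b'"
  shows "potential \<eta> N R d a b k + potential \<eta> N R d a' b' k + potential \<eta> N R d a' b (Suc k)
      + 3000 * real ((nn + mm + 1) * R) \<le> potential \<eta> N R d nn mm k"
proof -
  define \<theta> \<mu> where "\<theta> = \<eta>^4" "\<mu> = 201 * \<eta>^6"
  note defs = this
  have \<theta>: "0 < \<theta>" "\<theta> < 1" and \<mu>: "0 < \<mu>" "\<mu> < 1" using eta_small[OF \<eta>] \<eta> by (auto simp: defs)
  define lam where "lam = (1 / (1 - \<mu>)) ^ (d - k)"
  have lam: "1 \<le> lam" "(1 / (1 - \<mu>)) ^ (d - Suc k) = (1 - \<mu>) * lam"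
  proof -
    show "1 \<le> lam" unfolding lam_def using \<mu> by (intro one_le_power) auto
    have "d - k = Suc (d - Suc k)" using k by simp
    then show "(1 / (1 - \<mu>)) ^ (d - Suc k) = (1 - \<mu>) * lam" using \<mu> by (simp add: lam_def)
  qed
  define F where "F = 90 * real R / \<eta>^6 * N powr \<theta> * lam"
  have F: "0 \<le> F" using \<eta> lam by (simp add: F_def)
  define w where "w = real (nn * mm) powr (1 - \<theta>)"
  have "real (nn + mm + 1) / 3 \<le> N powr \<theta> * w"
  proof -
    define M where "M = max nn mm"
    have M: "0 < M" "real M \<le> N" "nn + mm + 1 \<le> 3 * M" using pos N by (auto simp: M_def)
    \<comment> \<open>In \<open>M = M powr \<theta> * M powr (1 - \<theta>)\<close> the first factor
      is compared with \<open>N\<close> and the second with \<open>nn * mm\<close>.\<close>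
    have "M \<le> nn * mm" using pos by (auto simp: M_def)
    then have "real M \<le> real (nn * mm)" by (rule of_nat_mono)
    then have "real M powr \<theta> * real M powr (1 - \<theta>) \<le> N powr \<theta> * w"
      unfolding w_def using M \<theta> by (intro mult_mono powr_mono2) auto
    moreover have "real M powr \<theta> * real M powr (1 - \<theta>) = real M" using M by (simp add: powr_add[symmetric])
    moreover have "real (nn + mm + 1) \<le> real (3 * M)" using M(3) by (rule of_nat_mono)
    ultimately show ?thesis by simp
  qed
  \<comment> \<open>9000 is both 3000 times the 3 in \<open>nn + mm + 1 <= 3 * M\<close>, and 100
    from the gain times the leading 90 of the potential.\<close>
  then have "9000 * real R * (real (nn + mm + 1) / 3) * 1 \<le> 9000 * real R * (N powr \<theta> * w) * lam"
    using lam by (intro mult_mono mult_left_mono mult_nonneg_nonneg) (auto simp: w_def)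
  also have "\<dots> = 100 * \<eta>^6 * (F * w)" using \<eta> by (simp add: F_def)
  finally have cost: "3000 * real ((nn + mm + 1) * R) \<le> 100 * \<eta>^6 * (F * w)" by (simp add: algebra_simps)
  have "F * (real (a * b) powr (1 - \<theta>) + real (a' * b') powr (1 - \<theta>) + (1 - \<mu>) * real (a' * b) powr (1 - \<theta>))
      \<le> F * ((1 - 100 * \<eta>^6) * w)"
    using splits_powr[OF \<eta> s pos] F unfolding w_def defs by (rule mult_left_mono)
  moreover have "potential \<eta> N R d a b k = F * real (a * b) powr (1 - \<theta>)"
    "potential \<eta> N R d a' b' k = F * real (a' * b') powr (1 - \<theta>)"
    "potential \<eta> N R d nn mm k = F * w"
    "potential \<eta> N R d a' b (Suc k) = F * ((1 - \<mu>) * real (a' * b) powr (1 - \<theta>))"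
    unfolding potential_def defs[symmetric] lam(2) lam_def[symmetric] F_def w_def by (simp_all add: mult_ac)
  ultimately show ?thesis using cost by (simp add: algebra_simps)
qed

lemma Program_terminates:
  assumes \<eta>: "0 < \<eta>" "\<eta> \<le> 1/6" and xs: "enumerates d xs A" and ys: "enumerates d ys B"
    and N: "real (length xs) \<le> N" "real (length ys) \<le> N" and r: "length xs + length ys \<le> 2 ^ r"
  shows "\<exists>t \<tau>. exec Program (input_state d xs ys) t \<tau> \<and> correct_output xs ys \<tau> \<and>
    real t \<le> potential \<eta> N (r + d + 1) d (length xs) (length ys) 0
      + 600 * real ((length xs + length ys + 1) * (d + 1))"
proof (rule wp_Program)
  show "length u = d" if "u \<in> set xs \<union> set ys" for u using that xs ys by (auto simp: enumerates_def)
  show "0 \<le> potential \<eta> N (r + d + 1) d a b k" for a b k by (rule potential_nonneg[OF \<eta>])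
  show "length xs + length ys \<le> 2 ^ r" by (rule r)
next
  fix k nn mm a b a' b'
  assume "k < d" "0 < nn" "0 < mm" "nn \<le> length xs" "mm \<le> length ys" "points.splits nn mm a b a' b'"
  then show "potential \<eta> N (r + d + 1) d a b k + potential \<eta> N (r + d + 1) d a' b' k +
      potential \<eta> N (r + d + 1) d a' b (Suc k) + 3000 * real ((nn + mm + 1) * (r + d + 1))
      \<le> potential \<eta> N (r + d + 1) d nn mm k"
    using N by (intro potential_decreases \<eta>) auto
qed

text \<open>Correctness carries no time bound, so crude parameters do: \<eta> = 1/6, and the number
  of points itself as the bound \<open>r\<close> on its logarithm.\<close>

lemma solves_Program: "solves_vector_domination Program"
  unfolding solves_vector_domination_def
proof (intro allI impI)
  fix d A B xs ys
  assume "enumerates d xs A" "enumerates d ys B"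
  moreover have "length xs + length ys \<le> 2 ^ (length xs + length ys)"
    using less_exp[of "length xs + length ys"] by (rule less_imp_le)
  ultimately show "\<exists>t \<tau>. exec Program (input_state d xs ys) t \<tau> \<and> correct_output xs ys \<tau>"
    using Program_terminates[of "1/6" d xs A ys B "real (length xs + length ys)" "length xs + length ys"] by auto
qed

section \<open>Choice of the parameter for given \<open>c\<close>, and the exponent\<close>

definition eta :: "real \<Rightarrow> real" where
  "eta c = 1 / (60 * sqrt (max 1 c))"

text \<open>The square 3600 leaves room above the 3216 = 16 * 201 needed for
  \<open>4 * \<mu> * c <= \<theta> / 4\<close> in \<open>time_bound\<close>. The maximum keeps
  \<open>eta\<close> small when \<open>c\<close> is small.\<close>

lemma eta_bounds: "0 < eta c" "eta c \<le> 1/60" "3600 * max 1 c * (eta c)^2 = 1"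
proof -
  have "1 \<le> sqrt (max 1 c)" by simp
  then show "0 < eta c" "eta c \<le> 1/60" by (auto simp: eta_def field_simps)
  show "3600 * max 1 c * (eta c)^2 = 1"
    by (simp add: eta_def power_divide power_mult_distrib)
qed

text \<open>Serves to absorb logarithmic factors of the running time into a small power.\<close>

lemma ln_le_powr: "1 \<le> x \<Longrightarrow> 0 < e \<Longrightarrow> ln x \<le> x powr e / e" for x e :: real
  using ln_le_minus_one[of "x powr e"] by (simp add: ln_powr field_simps)

text \<open>The initial potential contributes \<open>N powr (2 - \<theta>)\<close>; the cost factor
  \<open>r + d + 1\<close> and the product over the dimensions each cost another
  \<open>N powr (\<theta> / 4)\<close>. The summands 1 and 2 in the hypotheses leave room for
  rounding \<open>d\<close> and for a logarithm of \<open>2 * N\<close>.\<close>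

lemma time_bound:
  assumes "0 < c"
  defines "\<theta> \<equiv> (eta c)^4"
  shows "\<exists>C. \<forall>(N::nat) d r. 1 \<le> N \<longrightarrow> real d \<le> c * log 2 N + 1 \<longrightarrow> real r \<le> log 2 N + 2 \<longrightarrow>
    potential (eta c) N (r + d + 1) d N N 0 + 600 * real ((N + N + 1) * (d + 1)) \<le> C * real N powr (2 - \<theta> / 2)"
proof -
  define \<eta> \<mu> where "\<eta> = eta c" "\<mu> = 201 * \<eta>^6"
  note defs = this
  have \<eta>: "0 < \<eta>" "\<eta> \<le> 1/6" using eta_bounds[of c] by (auto simp: defs)
  have \<theta>: "0 < \<theta>" "\<theta> < 1" and \<mu>: "0 < \<mu>" "\<mu> \<le> 1/2"
    using eta_small[OF \<eta>] \<eta> by (auto simp: \<theta>_def defs)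
  have \<mu>c: "4 * \<mu> * c \<le> \<theta> / 4"
  proof -
    have "3216 * c * \<eta>^2 \<le> 3600 * max 1 c * \<eta>^2" using assms(1) by (intro mult_right_mono) auto
    then have "3216 * c * \<eta>^2 * \<eta>^4 \<le> 1 * \<eta>^4"
      using eta_bounds(3)[of c] by (intro mult_right_mono) (auto simp: defs)
    moreover have "\<eta>^6 = \<eta>^2 * \<eta>^4" by (simp add: power_add[symmetric])
    ultimately have "3216 * (c * \<eta>^6) \<le> \<eta>^4" by (simp only: mult.assoc mult_1_left)
    then show ?thesis by (simp add: \<theta>_def defs algebra_simps)
  qed
  \<comment> \<open>\<open>8 / \<theta>\<close> comes from \<open>log 2 x <= 2 * ln x\<close> and
    \<open>ln x <= x powr (\<theta> / 4) * 4 / \<theta>\<close>; the summand 4 collects the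
    constants in \<open>r + d + 1\<close>.\<close>
  define D where "D = (1 + c) * 8 / \<theta> + 4"
  have D: "0 \<le> D" using \<theta> assms(1) by (simp add: D_def)
  define C where "C = 90 * D / \<eta>^6 * 3 + 1800 * D"
  show ?thesis
  proof (intro exI[of _ C] allI impI)
    fix N d r :: nat
    assume N: "1 \<le> N" and d: "real d \<le> c * log 2 N + 1" and r: "real r \<le> log 2 N + 2"
    define x where "x = real N"
    have x: "1 \<le> x" using N by (simp add: x_def)
    have ln2: "1/2 \<le> ln (2::real)"
    proof -
      have "exp (1/2) ^ 2 \<le> (2::real)^2" using exp_le by (simp add: power2_eq_square exp_add[symmetric])
      then have "exp (1/2) \<le> (2::real)" by (rule power2_le_imp_le) simp
      then show ?thesis using ln_ge_iff[of 2 "1/2"] by simp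
    qed
    have lnx: "0 \<le> ln x" using x by simp
    have log: "log 2 x \<le> 2 * ln x"
      using mult_left_mono[OF ln2 lnx] ln2 by (simp add: log_def field_simps)
    have pw: "1 \<le> x powr (\<theta> / 4)" using x \<theta> by (simp add: ge_one_powr_ge_zero)
    have "ln x \<le> x powr (\<theta> / 4) / (\<theta> / 4)" using x \<theta> by (intro ln_le_powr) auto
    then have logx: "log 2 x \<le> 8 / \<theta> * x powr (\<theta> / 4)" using log by simp
    have R: "real (r + d + 1) \<le> D * x powr (\<theta> / 4)"
    proof -
      have "real (r + d + 1) \<le> (1 + c) * log 2 x + 4" using d r by (simp add: x_def algebra_simps)
      also have "\<dots> \<le> (1 + c) * (8 / \<theta> * x powr (\<theta> / 4)) + 4 * x powr (\<theta> / 4)"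
        using logx pw assms(1) by (intro add_mono mult_left_mono) auto
      also have "\<dots> = D * x powr (\<theta> / 4)" by (simp add: D_def algebra_simps)
      finally show ?thesis .
    qed
    have lam: "(1 / (1 - \<mu>)) ^ d \<le> 3 * x powr (\<theta> / 4)"
    proof -
      have "1 / (1 - \<mu>) \<le> 1 + 2 * \<mu>" using \<mu> by (simp add: field_simps)
      also have "\<dots> \<le> exp (2 * \<mu>)" by (rule exp_ge_add_one_self)
      finally have "(1 / (1 - \<mu>)) ^ d \<le> exp (2 * \<mu>) ^ d" using \<mu> by (intro power_mono) auto
      also have "\<dots> = exp (2 * \<mu> * real d)" by (simp add: exp_of_nat_mult[symmetric] mult.commute)
      \<comment> \<open>The summand 1 absorbs the rounding of \<open>d\<close>, at the price of a
        factor \<open>exp 1\<close>, which is at most 3.\<close>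
      also have "\<dots> \<le> exp (1 + \<theta> / 4 * ln x)"
      proof -
        have "c * log 2 x \<le> c * (2 * ln x)" using log assms(1) by (intro mult_left_mono) auto
        then have "real d \<le> c * (2 * ln x) + 1" using d unfolding x_def by linarith
        then have "2 * \<mu> * real d \<le> 2 * \<mu> * (c * (2 * ln x) + 1)"
          using \<mu> by (intro mult_left_mono) auto
        also have "\<dots> = 2 * \<mu> + 4 * \<mu> * c * ln x" by (simp add: algebra_simps)
        also have "\<dots> \<le> 1 + \<theta> / 4 * ln x" using \<mu> \<mu>c lnx by (intro add_mono mult_right_mono) auto
        finally show ?thesis by simp
      qed
      also have "\<dots> = exp 1 * x powr (\<theta> / 4)" using x by (simp add: exp_add powr_def)
      also have "\<dots> \<le> 3 * x powr (\<theta> / 4)" using exp_le by (intro mult_right_mono) auto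
      finally show ?thesis .
    qed
    have "potential \<eta> N (r + d + 1) d N N 0 =
        90 * real (r + d + 1) / \<eta>^6 * (x powr \<theta> * (x * x) powr (1 - \<theta>)) * (1 / (1 - \<mu>)) ^ d"
      by (simp add: potential_def \<theta>_def defs x_def)
    also have "x powr \<theta> * (x * x) powr (1 - \<theta>) = x powr (2 - \<theta>)"
      using x by (simp add: powr_mult powr_add[symmetric])
    also have "90 * real (r + d + 1) / \<eta>^6 * x powr (2 - \<theta>) * (1 / (1 - \<mu>)) ^ d
        \<le> 90 * (D * x powr (\<theta> / 4)) / \<eta>^6 * x powr (2 - \<theta>) * (3 * x powr (\<theta> / 4))"
      using R lam \<eta> \<mu> D by (intro mult_mono divide_right_mono mult_left_mono) auto
    also have "\<dots> = 90 * D / \<eta>^6 * 3 * (x powr (\<theta> / 4) * x powr (2 - \<theta>) * x powr (\<theta> / 4))" by simp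
    also have "x powr (\<theta> / 4) * x powr (2 - \<theta>) * x powr (\<theta> / 4) = x powr (2 - \<theta> / 2)"
      by (simp add: powr_add[symmetric])
    finally have 1: "potential \<eta> N (r + d + 1) d N N 0 \<le> 90 * D / \<eta>^6 * 3 * x powr (2 - \<theta> / 2)" .
    have "real ((N + N + 1) * (d + 1)) \<le> (3 * x) * (D * x powr (\<theta> / 4))"
      using R x D unfolding of_nat_mult by (intro mult_mono) (auto simp: x_def)
    also have "\<dots> = 3 * D * (x powr 1 * x powr (\<theta> / 4))" using x by simp
    also have "x powr 1 * x powr (\<theta> / 4) \<le> x powr (2 - \<theta> / 2)"
      unfolding powr_add[symmetric] using x \<theta> by (intro powr_mono) auto
    finally have 2: "real ((N + N + 1) * (d + 1)) \<le> 3 * D * x powr (2 - \<theta> / 2)" using D by (simp add: mult_left_mono)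
    show "potential (eta c) N (r + d + 1) d N N 0 + 600 * real ((N + N + 1) * (d + 1))
        \<le> C * real N powr (2 - \<theta> / 2)"
      using 1 2 unfolding C_def defs(1)[symmetric] x_def[symmetric] by (simp add: algebra_simps)
  qed
qed

theorem lemma3p1:
  "\<exists>(p :: com) (s :: real \<Rightarrow> real).
     solves_vector_domination p \<and>
     (\<forall>c > 0. 0 < s c \<and> s c < 1) \<and>
     (\<exists>\<delta> > 0. \<exists>K > 0. \<forall>c \<ge> 1. s c \<ge> \<delta> * c powr (- K)) \<and>
     (\<forall>c > 0. \<exists>C :: real. \<forall>(N :: nat) (d :: nat) (A :: real list set) (B :: real list set) xs ys.
        N \<ge> 1 \<longrightarrow>
        d \<in> {nat \<lfloor>c * log 2 (real N)\<rfloor>, nat \<lceil>c * log 2 (real N)\<rceil>} \<longrightarrow>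
        card A = N \<longrightarrow> card B = N \<longrightarrow>
        enumerates d xs A \<longrightarrow> enumerates d ys B \<longrightarrow>
        halts_within p (input_state d xs ys) (C * real N powr (2 - s c)))"
proof (rule exI[of _ Program], rule exI[of _ "\<lambda>c. (eta c)^4 / 2"], intro conjI allI impI)
  show "solves_vector_domination Program" by (rule solves_Program)
next
  fix c :: real
  assume "0 < c"
  show "0 < (eta c)^4 / 2" using eta_bounds(1)[of c] by simp
  show "(eta c)^4 / 2 < 1" using eta_small(1)[of "eta c"] eta_bounds(1,2)[of c] by simp
next
  \<comment> \<open>25920000 is \<open>2 * 60^4\<close>. For \<open>c >= 1\<close> the maximum in
    \<open>eta\<close> is \<open>c\<close>, so the saving is a constant times \<open>1 / c^2\<close>
    and K = 2.\<close>
  have "(eta c)^4 / 2 \<ge> 1 / 25920000 * c powr (- 2)" if c: "1 \<le> c" for c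
  proof -
    have "3600 * c * (eta c)^2 = 1" using c eta_bounds(3)[of c] by (simp add: max_def)
    then have "(eta c)^2 = 1 / (3600 * c)" using c by (simp add: field_simps)
    then have "((eta c)^2)^2 = 1 / 12960000 * (1 / c^2)" by (simp add: power_divide power_mult_distrib)
    moreover have "((eta c)^2)^2 = (eta c)^4" by (simp add: power_mult[symmetric])
    moreover have "c powr (- 2) = 1 / c^2" using c by (simp add: powr_minus_divide)
    ultimately show ?thesis by linarith
  qed
  then show "\<exists>\<delta>>0. \<exists>K>0. \<forall>c\<ge>1. (eta c)^4 / 2 \<ge> \<delta> * c powr (- K)"
    by (intro exI[of _ "1 / 25920000"] exI[of _ 2] conjI allI impI) simp_all
next
  fix c :: real
  assume c: "0 < c"
  obtain C where C: "\<And>(N::nat) d r. 1 \<le> N \<Longrightarrow> real d \<le> c * log 2 N + 1 \<Longrightarrow> real r \<le> log 2 N + 2 \<Longrightarrow>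
      potential (eta c) N (r + d + 1) d N N 0 + 600 * real ((N + N + 1) * (d + 1))
        \<le> C * real N powr (2 - (eta c)^4 / 2)"
    using time_bound[OF c] by blast
  show "\<exists>C. \<forall>(N::nat) (d::nat) (A :: real list set) (B :: real list set) xs ys. N \<ge> 1 \<longrightarrow>
      d \<in> {nat \<lfloor>c * log 2 (real N)\<rfloor>, nat \<lceil>c * log 2 (real N)\<rceil>} \<longrightarrow>
      card A = N \<longrightarrow> card B = N \<longrightarrow> enumerates d xs A \<longrightarrow> enumerates d ys B \<longrightarrow>
      halts_within Program (input_state d xs ys) (C * real N powr (2 - (eta c)^4 / 2))"
  proof (intro exI[of _ C] allI impI)
    fix N d :: nat and A B :: "real list set" and xs ys
    assume N: "1 \<le> N" and d: "d \<in> {nat \<lfloor>c * log 2 (real N)\<rfloor>, nat \<lceil>c * log 2 (real N)\<rceil>}"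
      and card: "card A = N" "card B = N" and enum: "enumerates d xs A" "enumerates d ys B"
    have len: "length xs = N" "length ys = N"
      using card enum distinct_card[of xs] distinct_card[of ys] by (auto simp: enumerates_def)
    have lg: "0 \<le> log 2 N" using N by simp
    then have "0 \<le> c * log 2 N" using c by simp
    then have d': "real d \<le> c * log 2 N + 1" using d by (auto; linarith)
    \<comment> \<open>One more than the rounded logarithm of \<open>N\<close>, since A and B
      together have \<open>2 * N\<close> points.\<close>
    define r where "r = nat \<lceil>log 2 N\<rceil> + 1"
    have r: "real r \<le> log 2 N + 2" using lg unfolding r_def by linarith
    have "N + N \<le> 2 ^ r"
    proof -
      have "log 2 N \<le> real (nat \<lceil>log 2 N\<rceil>)" using lg by linarith
      then have "real N \<le> 2 powr real (nat \<lceil>log 2 N\<rceil>)" using N by (subst (asm) log_le_iff) auto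
      then have "real N \<le> real (2 ^ nat \<lceil>log 2 N\<rceil>)" by (simp add: powr_realpow)
      then have "N \<le> 2 ^ nat \<lceil>log 2 N\<rceil>" by (simp only: of_nat_le_iff)
      then show ?thesis by (simp add: r_def)
    qed
    then obtain t \<tau> where "exec Program (input_state d xs ys) t \<tau>"
      "real t \<le> potential (eta c) N (r + d + 1) d N N 0 + 600 * real ((N + N + 1) * (d + 1))"
      using Program_terminates[of "eta c" d xs A ys B "real N" r] eta_bounds(1,2)[of c] enum by (auto simp: len)
    then show "halts_within Program (input_state d xs ys) (C * real N powr (2 - (eta c)^4 / 2))"
      using C[OF N d' r] unfolding halts_within_def by force
  qed
qed

end
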